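(* Let $\mathcal{M}=\mathcal{M}(\Sigma,I)$ be an irreducible trace monoid, and let $p_0$ be the unique root of smallest modulus of the single-variable Möbius polynomial $\mu_{\mathcal{M}}(X)=\sum_{c\in\mathscr{C}}(-1)^{|c|}X^{|c|}$. Then: 1. There exists a unique uniform Bernoulli measure $\mathbb{P}_0$ on $(\partial\mathcal{M},\mathfrak{F})$. It is entirely characterized by $\mathbb{P}_0(\uparrow u)=p_0^{|u|}$ for all $u\in\mathcal{M}$. 2. Any uniform measure on $(\partial\mathcal{M},\mathfrak{F})$ is uniform Bernoulli. Hence $\mathbb{P}_0$ is also the unique uniform measure on $(\partial\mathcal{M},\mathfrak{F})$.
   Context: Trace monoids. An independence pair $(\Sigma,I)$ consists of a finite non-empty set $\Sigma$ (letters) and an irreflexive symmetric relation $I\subseteq\Sigma\times\Sigma$. The trace monoid is $\mathcal{M}=\mathcal{M}(\Sigma,I)=\langle\Sigma\mid\alpha\cdot\beta=\beta\cdot\alpha\text{ for }(\alpha,\beta)\in I\rangle$; its elements are called traces, its unit is denoted $0$, and $|u|$ is the length of any word representing $u$. It is irreducible if the undirected graph $(\Sigma,D)$, with $D=(\Sigma\times\Sigma)\setminus I$, is connected. Left divisibility: $u\leq v$ iff $v=u\cdot w$ for some $w\in\mathcal{M}$; this is a partial order. Cliques. A clique is a trace $\alpha_1\cdot\ldots\cdot\alpha_n$, $n\geq0$, with $(\alpha_i,\alpha_j)\in I$ for all $i\neq j$. $\mathscr{C}$ is the (finite) set of cliques, including the empty clique $0$. Known fact. The polynomial $\mu_{\mathcal{M}}(X)$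 has a unique (complex) root of smallest modulus, and this root is real and positive. Boundary. Consider non-decreasing sequences $(u_k)_{k\geq0}$ in $(\mathcal{M},\leq)$, pre-ordered by $(u_k)\preccurlyeq(u'_k)$ iff for every $k$ there is $k'$ with $u_k\leq u'_{k'}$. Let $(\mathcal{W},\leq)$ be the partial order obtained by quotienting by the associated equivalence. $\mathcal{M}$ embeds in $\mathcal{W}$ through constant sequences. The boundary is $\partial\mathcal{M}=\mathcal{W}\setminus\mathcal{M}$. For $u\in\mathcal{M}$, $\uparrow u=\{\xi\in\partial\mathcal{M}: u\leq\xi\}$, and $\mathfrak{F}$ is the $\sigma$-algebra on $\partial\mathcal{M}$ generated by all sets $\uparrow u$, $u\in\mathcal{M}$. Measures. A probability measure $\mathbb{P}$ on $(\partial\mathcal{M},\mathfrak{F})$ is Bernoulli if $\mathbb{P}(\uparrow u)>0$ for all $u\in\mathcal{M}$ and $\mathbb{P}(\uparrow(u\cdot v))=\mathbb{P}(\uparrow u)\,\mathbb{P}(\uparrow v)$ for all $u,v\in\mathcal{M}$. It is uniform Bernoulli if it is Bernoulli and the numbers $\mathbb{P}(\uparrow\alpha)$, $\alpha\in\Sigma$, are all equal. A probability measure $\mathbb{P}$ on $(\partial\mathcal{M},\mathfrak{F})$ is uniform if for all $u,v\in\mathcal{M}$, $|u|=|v|$ implies $\mathbb{P}(\uparrow u)=\mathbb{P}(\uparrow v)$. *)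

theory Defs
  imports "HOL-Probability.Probability" "HOL-Computational_Algebra.Polynomial"
    "HOL-Algebra.Divisibility"
begin

definition independence_pair :: "'a set \<Rightarrow> ('a \<times> 'a) set \<Rightarrow> bool" where
  "independence_pair S I \<longleftrightarrow>
     finite S \<and> S \<noteq> {} \<and> I \<subseteq> S \<times> S \<and> irrefl I \<and> sym I"

inductive trace_eq :: "('a \<times> 'a) set \<Rightarrow> 'a list \<Rightarrow> 'a list \<Rightarrow> bool" for I where
  comm: "(a, b) \<in> I \<Longrightarrow> trace_eq I [a, b] [b, a]"
| refl: "trace_eq I u u"
| sym: "trace_eq I u v \<Longrightarrow> trace_eq I v u"
| trans: "trace_eq I u v \<Longrightarrow> trace_eq I v w \<Longrightarrow> trace_eq I u w"
| cong: "trace_eq I u u' \<Longrightarrow> trace_eq I v v' \<Longrightarrow> trace_eq I (u @ v) (u' @ v')"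

definition trace_rel :: "'a set \<Rightarrow> ('a \<times> 'a) set \<Rightarrow> ('a list \<times> 'a list) set" where
  "trace_rel S I = {(u, v). u \<in> lists S \<and> v \<in> lists S \<and> trace_eq I u v}"

definition trace_of :: "'a set \<Rightarrow> ('a \<times> 'a) set \<Rightarrow> 'a list \<Rightarrow> 'a list set" where
  "trace_of S I w = trace_rel S I `` {w}"

definition trace_monoid :: "'a set \<Rightarrow> ('a \<times> 'a) set \<Rightarrow> 'a list set monoid" where
  "trace_monoid S I =
     \<lparr>carrier = lists S // trace_rel S I,
      monoid.mult = (\<lambda>u v. \<Union>x\<in>u. \<Union>y\<in>v. trace_of S I (x @ y)),
      one = trace_of S I []\<rparr>"

definition trace_length :: "'a list set \<Rightarrow> nat" where
  "trace_length u = length (SOME w. w \<in> u)"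

definition irreducible_pair :: "'a set \<Rightarrow> ('a \<times> 'a) set \<Rightarrow> bool" where
  "irreducible_pair S I \<longleftrightarrow> (\<forall>a\<in>S. \<forall>b\<in>S. (a, b) \<in> (S \<times> S - I)\<^sup>*)"

definition cliques :: "'a set \<Rightarrow> ('a \<times> 'a) set \<Rightarrow> 'a list set set" where
  "cliques S I = {trace_of S I w | w. w \<in> lists S \<and>
     (\<forall>i<length w. \<forall>j<length w. i \<noteq> j \<longrightarrow> (w ! i, w ! j) \<in> I)}"

definition moebius_poly :: "'a set \<Rightarrow> ('a \<times> 'a) set \<Rightarrow> complex poly" where
  "moebius_poly S I =
     (\<Sum>c\<in>cliques S I. monom ((-1) ^ trace_length c) (trace_length c))"

definition unique_smallest_root :: "complex poly \<Rightarrow> complex \<Rightarrow> bool" where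
  "unique_smallest_root p z \<longleftrightarrow>
     poly p z = 0 \<and> (\<forall>w. poly p w = 0 \<and> w \<noteq> z \<longrightarrow> cmod z < cmod w)"

text \<open>The relation \<open>u divides\<^bsub>M\<^esub> v\<close> of HOL-Algebra is left divisibility:
  \<open>v = u \<otimes>\<^bsub>M\<^esub> w\<close> for some \<open>w\<close> in the carrier.\<close>

definition trace_seqs :: "'a set \<Rightarrow> ('a \<times> 'a) set \<Rightarrow> (nat \<Rightarrow> 'a list set) set" where
  "trace_seqs S I = {s. (\<forall>k. s k \<in> carrier (trace_monoid S I)) \<and>
     (\<forall>j k. j \<le> k \<longrightarrow> s j divides\<^bsub>trace_monoid S I\<^esub> s k)}"

definition seq_le ::
  "'a set \<Rightarrow> ('a \<times> 'a) set \<Rightarrow> (nat \<Rightarrow> 'a list set) \<Rightarrow> (nat \<Rightarrow> 'a list set) \<Rightarrow> bool" where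
  "seq_le S I s t \<longleftrightarrow> (\<forall>k. \<exists>k'. s k divides\<^bsub>trace_monoid S I\<^esub> t k')"

definition seq_rel ::
  "'a set \<Rightarrow> ('a \<times> 'a) set \<Rightarrow> ((nat \<Rightarrow> 'a list set) \<times> (nat \<Rightarrow> 'a list set)) set" where
  "seq_rel S I = {(s, t). s \<in> trace_seqs S I \<and> t \<in> trace_seqs S I \<and>
     seq_le S I s t \<and> seq_le S I t s}"

definition gen_traces :: "'a set \<Rightarrow> ('a \<times> 'a) set \<Rightarrow> (nat \<Rightarrow> 'a list set) set set" where
  "gen_traces S I = trace_seqs S I // seq_rel S I"

definition gen_le ::
  "'a set \<Rightarrow> ('a \<times> 'a) set \<Rightarrow> (nat \<Rightarrow> 'a list set) set \<Rightarrow> (nat \<Rightarrow> 'a list set) set \<Rightarrow> bool"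
  where "gen_le S I \<xi> \<eta> \<longleftrightarrow> (\<exists>s\<in>\<xi>. \<exists>t\<in>\<eta>. seq_le S I s t)"

definition embed :: "'a set \<Rightarrow> ('a \<times> 'a) set \<Rightarrow> 'a list set \<Rightarrow> (nat \<Rightarrow> 'a list set) set" where
  "embed S I u = seq_rel S I `` {\<lambda>_. u}"

definition boundary :: "'a set \<Rightarrow> ('a \<times> 'a) set \<Rightarrow> (nat \<Rightarrow> 'a list set) set set" where
  "boundary S I = gen_traces S I - embed S I ` carrier (trace_monoid S I)"

definition up :: "'a set \<Rightarrow> ('a \<times> 'a) set \<Rightarrow> 'a list set \<Rightarrow> (nat \<Rightarrow> 'a list set) set set" where
  "up S I u = {\<xi> \<in> boundary S I. gen_le S I (embed S I u) \<xi>}"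

definition boundary_space ::
  "'a set \<Rightarrow> ('a \<times> 'a) set \<Rightarrow> (nat \<Rightarrow> 'a list set) set measure" where
  "boundary_space S I = sigma (boundary S I) (up S I ` carrier (trace_monoid S I))"

definition boundary_prob ::
  "'a set \<Rightarrow> ('a \<times> 'a) set \<Rightarrow> (nat \<Rightarrow> 'a list set) set measure \<Rightarrow> bool" where
  "boundary_prob S I P \<longleftrightarrow> prob_space P \<and> sets P = sets (boundary_space S I)"

definition bernoulli_measure ::
  "'a set \<Rightarrow> ('a \<times> 'a) set \<Rightarrow> (nat \<Rightarrow> 'a list set) set measure \<Rightarrow> bool" where
  "bernoulli_measure S I P \<longleftrightarrow> boundary_prob S I P \<and>
     (\<forall>u\<in>carrier (trace_monoid S I). measure P (up S I u) > 0) \<and>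
     (\<forall>u\<in>carrier (trace_monoid S I). \<forall>v\<in>carrier (trace_monoid S I).
        measure P (up S I (u \<otimes>\<^bsub>trace_monoid S I\<^esub> v)) =
        measure P (up S I u) * measure P (up S I v))"

definition uniform_bernoulli_measure ::
  "'a set \<Rightarrow> ('a \<times> 'a) set \<Rightarrow> (nat \<Rightarrow> 'a list set) set measure \<Rightarrow> bool" where
  "uniform_bernoulli_measure S I P \<longleftrightarrow> bernoulli_measure S I P \<and>
     (\<forall>a\<in>S. \<forall>b\<in>S.
        measure P (up S I (trace_of S I [a])) = measure P (up S I (trace_of S I [b])))"

definition uniform_boundary_measure ::
  "'a set \<Rightarrow> ('a \<times> 'a) set \<Rightarrow> (nat \<Rightarrow> 'a list set) set measure \<Rightarrow> bool" where
  "uniform_boundary_measure S I P \<longleftrightarrow> boundary_prob S I P \<and>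
     (\<forall>u\<in>carrier (trace_monoid S I). \<forall>v\<in>carrier (trace_monoid S I).
        trace_length u = trace_length v \<longrightarrow>
        measure P (up S I u) = measure P (up S I v))"

lemma trace_eq_length: "trace_eq I u v \<Longrightarrow> length u = length v"
  by (induction rule: trace_eq.induct) auto

lemma equiv_trace_rel: "equiv (lists S) (trace_rel S I)"
proof (rule equivI)
  show "trace_rel S I \<subseteq> lists S \<times> lists S"
    by (auto simp: trace_rel_def)
  show "refl_on (lists S) (trace_rel S I)"
    by (simp add: trace_rel_def refl_on_def trace_eq.refl)
  show "sym (trace_rel S I)"
    by (simp add: trace_rel_def sym_def trace_eq.sym)
  show "trans (trace_rel S I)"
    unfolding trace_rel_def trans_def using trace_eq.trans[of I] by blast
qed

lemma trace_length_trace_of: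
  assumes "w \<in> lists S"
  shows "trace_length (trace_of S I w) = length w"
proof -
  have "w \<in> trace_of S I w"
    using assms by (auto simp: trace_of_def trace_rel_def intro: trace_eq.refl)
  hence "(SOME x. x \<in> trace_of S I w) \<in> trace_of S I w"
    by (rule someI)
  moreover have "length v = length w" if "v \<in> trace_of S I w" for v
    using that trace_eq_length[of I w v] by (simp add: trace_of_def trace_rel_def)
  ultimately show ?thesis
    unfolding trace_length_def by blast
qed

lemma trace_mult_trace_of:
  assumes "x \<in> lists S" "y \<in> lists S"
  shows "trace_of S I x \<otimes>\<^bsub>trace_monoid S I\<^esub> trace_of S I y = trace_of S I (x @ y)"
proof -
  have *: "trace_of S I (x' @ y') = trace_of S I (x @ y)"
    if "x' \<in> trace_of S I x" "y' \<in> trace_of S I y" for x' y'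
    unfolding trace_of_def
  proof (rule equiv_class_eq[OF equiv_trace_rel])
    show "(x' @ y', x @ y) \<in> trace_rel S I"
      using that by (simp add: trace_of_def trace_rel_def trace_eq.cong trace_eq.sym)
  qed
  have "x \<in> trace_of S I x" "y \<in> trace_of S I y"
    using assms by (auto simp: trace_of_def trace_rel_def intro: trace_eq.refl)
  with * have "(\<Union>x'\<in>trace_of S I x. \<Union>y'\<in>trace_of S I y. trace_of S I (x' @ y')) =
      trace_of S I (x @ y)"
    by blast
  thus ?thesis
    by (simp add: trace_monoid_def)
qed

end

theory Submission
  imports Defs "HOL-Library.Sublist" "HOL-Computational_Algebra.Fundamental_Theorem_Algebra"
begin

text \<open>
  Two words are trace equivalent iff their projections to all pairs of dependent letters agree, and
  left divisibility is the prefix order on these projections. This makes traces cancellative, with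
  least upper bounds of bounded pairs.

  Write \<open>a\<^sub>n\<close> for the number of traces of length \<open>n\<close>. Moebius inversion gives
  \<open>(\<Sum>n. a\<^sub>n z\<^sup>n) \<mu>(z) = 1\<close>; as \<open>a\<close> is submultiplicative, \<open>a\<^sub>n R\<^sup>n \<ge> 1\<close> at the radius of convergence
  \<open>R\<close>, so \<open>\<mu>(R) = 0\<close> and \<open>p\<^sub>0 = R\<close>.

  Existence: the distributions on traces with weights proportional to \<open>s\<^sup>|\<^sup>u\<^sup>|\<close>, \<open>s < R\<close>, give the set of
  multiples of \<open>u\<close> the mass \<open>s\<^sup>|\<^sup>u\<^sup>|\<close>. A cluster point as \<open>s \<rightarrow> R\<close> is a finitely additive measure that
  vanishes on single traces; it becomes countably additive by compactness and lives on the boundary.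

  Uniqueness: if \<open>f n\<close> is the common mass of \<open>up u\<close> for \<open>|u| = n\<close>, inclusion-exclusion yields a
  linear recurrence for \<open>f\<close> with characteristic polynomial \<open>\<mu>\<close>. Let \<open>w\<close> spell a walk through all letters
  in the dependence graph, which is connected. The sets \<open>up (u w)\<close>, \<open>|u| = n\<close>, are pairwise disjoint,
  so that \<open>a\<^sub>n f(n + |w|) \<le> 1\<close> and \<open>f n = O(R\<^sup>n)\<close>. As all other roots of \<open>\<mu>\<close> have larger modulus, this
  forces \<open>f n = R\<^sup>n\<close>.
\<close>

section \<open>Words modulo commutation\<close>

text \<open>The case \<open>x = y\<close> is included; it records the number of occurrences of
  \<open>x\<close>.\<close>

definition proj :: "'a \<Rightarrow> 'a \<Rightarrow> 'a list \<Rightarrow> 'a list" where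
  "proj x y w = filter (\<lambda>a. a = x \<or> a = y) w"

text \<open>This is left divisibility by \<open>word_le_iff\<close>. Stated through projections, it
  inherits transitivity and left cancellation from the prefix order.\<close>

definition word_le :: "('a \<times> 'a) set \<Rightarrow> 'a list \<Rightarrow> 'a list \<Rightarrow> bool" where
  "word_le I u t \<longleftrightarrow> (\<forall>x y. (x, y) \<notin> I \<longrightarrow> prefix (proj x y u) (proj x y t))"

lemma proj_Nil [simp]: "proj x y [] = []"
  and proj_Cons [simp]: "proj x y (a # u) = (if a = x \<or> a = y then a # proj x y u else proj x y u)"
  and proj_append [simp]: "proj x y (u @ v) = proj x y u @ proj x y v"
  by (auto simp: proj_def)

lemma set_proj [simp]: "set (proj x y u) = set u \<inter> {x, y}"
  by (auto simp: proj_def)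

lemma proj_commute: "proj x y u = proj y x u"
  by (simp add: proj_def disj_commute)

lemma proj_eq_Nil_iff [simp]: "proj x y u = [] \<longleftrightarrow> x \<notin> set u \<and> y \<notin> set u"
  by (auto simp: proj_def filter_empty_conv)

lemma count_list_proj: "z = x \<or> z = y \<Longrightarrow> count_list (proj x y u) z = count_list u z"
  by (induction u) auto

lemma word_leD: "word_le I u t \<Longrightarrow> (x, y) \<notin> I \<Longrightarrow> prefix (proj x y u) (proj x y t)"
  by (simp add: word_le_def)

lemma word_le_refl [simp]: "word_le I u u"
  by (simp add: word_le_def)

lemma word_le_trans: "word_le I u v \<Longrightarrow> word_le I v w \<Longrightarrow> word_le I u w"
  unfolding word_le_def by (meson prefix_order.trans)

lemma word_le_append_cancel [simp]: "word_le I (w @ u) (w @ v) \<longleftrightarrow> word_le I u v"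
  by (simp add: word_le_def)

lemma word_le_Cons_cancel [simp]: "word_le I (a # u) (a # v) \<longleftrightarrow> word_le I u v"
  using word_le_append_cancel[of I "[a]" u v] by simp

lemma word_le_append [simp]: "word_le I u (u @ v)"
  by (simp add: word_le_def)

lemma trace_eq_move_front:
  "(\<And>b. b \<in> set u \<Longrightarrow> (b, a) \<in> I) \<Longrightarrow> trace_eq I (u @ [a]) (a # u)"
proof (induction u)
  case Nil
  show ?case by (simp add: trace_eq.refl)
next
  case (Cons b u)
  have "trace_eq I ([b] @ (u @ [a])) ([b] @ (a # u))"
    using Cons by (intro trace_eq.cong trace_eq.refl) auto
  moreover have "trace_eq I ([b, a] @ u) ([a, b] @ u)"
    using Cons.prems by (intro trace_eq.cong trace_eq.refl trace_eq.comm) auto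
  ultimately show ?case
    by (auto intro: trace_eq.trans)
qed

locale independence =
  fixes I :: "('a \<times> 'a) set"
  assumes irrefl_I: "irrefl I" and sym_I: "sym I"
begin

lemma not_indep_refl [simp]: "(a, a) \<notin> I"
  using irrefl_I by (auto simp: irrefl_def)

lemma indep_sym: "(a, b) \<in> I \<Longrightarrow> (b, a) \<in> I"
  using sym_I by (auto simp: sym_def)

section \<open>Projections as a complete invariant of traces, and factors of words\<close>

lemma trace_eq_proj:
  "trace_eq I u v \<Longrightarrow> (x, y) \<notin> I \<Longrightarrow> proj x y u = proj x y v"
proof (induction rule: trace_eq.induct)
  case (comm a b)
  then show ?case using indep_sym[of a b] by auto
qed auto

lemma trace_eq_word_le: "trace_eq I u v \<Longrightarrow> word_le I u v"
  by (simp add: word_le_def trace_eq_proj)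

lemma word_le_set: "word_le I u v \<Longrightarrow> set u \<subseteq> set v"
proof
  fix x assume "word_le I u v" "x \<in> set u"
  then have "set (proj x x u) \<subseteq> set (proj x x v)"
    unfolding word_le_def by (metis not_indep_refl set_mono_prefix)
  then show "x \<in> set v" using \<open>x \<in> set u\<close> by auto
qed

lemma trace_eq_set: "trace_eq I u v \<Longrightarrow> set u = set v"
  by (simp add: subset_antisym trace_eq.sym trace_eq_word_le word_le_set)

lemma hd_proj_of_letter_le:
  assumes "word_le I (a # u) t" "(a, b) \<notin> I"
  shows "\<exists>s. proj a b t = a # s"
proof -
  have "prefix (proj a b (a # u)) (proj a b t)"
    using assms by (rule word_leD)
  then show ?thesis by (auto simp: prefix_def)
qed

text \<open>Induction on \<open>u\<close>: the first \<open>a\<close> of \<open>t\<close> can be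
  moved to the front, because an earlier letter \<open>b\<close> dependent on \<open>a\<close> would
  come first in \<open>proj a b t\<close>, which has to start with \<open>a\<close>. Then
  \<open>a\<close> cancels on both sides.\<close>

lemma word_le_imp_factor:
  "word_le I u t \<Longrightarrow> \<exists>z. trace_eq I (u @ z) t"
proof (induction u arbitrary: t)
  case Nil
  show ?case by (auto intro: trace_eq.refl)
next
  case (Cons a u)
  have "a \<in> set t" using word_le_set[OF Cons.prems] by auto
  then obtain t1 t2 where t: "t = t1 @ a # t2" and a: "a \<notin> set t1"
    by (meson split_list_first)
  have "(b, a) \<in> I" if b: "b \<in> set t1" for b
  proof (rule ccontr)
    assume "(b, a) \<notin> I"
    then have "(a, b) \<notin> I" using indep_sym by blast
    then obtain s where "proj a b t = a # s"
      using hd_proj_of_letter_le[OF Cons.prems] by blast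
    moreover obtain c s' where c: "proj a b t1 = c # s'"
      using b by (cases "proj a b t1") auto
    ultimately have "c = a" by (simp add: t)
    then have "a \<in> set (proj a b t1)" by (simp add: c)
    then show False using a by simp
  qed
  then have "trace_eq I ((t1 @ [a]) @ t2) ((a # t1) @ t2)"
    by (intro trace_eq.cong trace_eq.refl trace_eq_move_front)
  then have eq: "trace_eq I t (a # t1 @ t2)" by (simp add: t)
  then have "word_le I (a # u) (a # t1 @ t2)"
    using Cons.prems trace_eq_word_le word_le_trans by blast
  then have "word_le I u (t1 @ t2)" by simp
  then obtain z where "trace_eq I (u @ z) (t1 @ t2)" using Cons.IH by blast
  then have "trace_eq I ([a] @ u @ z) ([a] @ t1 @ t2)"
    by (rule trace_eq.cong[OF trace_eq.refl])
  then show ?case using eq trace_eq.sym trace_eq.trans by (metis append_Cons append_Nil)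
qed

lemma word_le_iff: "word_le I u t \<longleftrightarrow> (\<exists>z. trace_eq I (u @ z) t)"
  using word_le_imp_factor word_le_append word_le_trans trace_eq_word_le by blast

lemma word_le_length: "word_le I u t \<Longrightarrow> length u \<le> length t"
  using trace_eq_length by (fastforce simp: word_le_iff)

lemma word_le_same_length:
  assumes "word_le I u t" "length t \<le> length u" shows "trace_eq I u t"
proof -
  obtain z where z: "trace_eq I (u @ z) t" using assms(1) word_le_iff by blast
  have "length u + length z = length t" using trace_eq_length[OF z] by simp
  then have "length z = 0" using assms(2) by linarith
  then have "z = []" by simp
  then show ?thesis using z by simp
qed

text \<open>Equal projections give \<open>word_le\<close> in both directions, so the lengths agree
  and the cofactor is empty. Two-sided cancellation follows, since projections respect
  concatenation.\<close>

lemma trace_eq_iff_proj: "trace_eq I u v \<longleftrightarrow> (\<forall>x y. (x, y) \<notin> I \<longrightarrow> proj x y u = proj x y v)"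
proof
  assume *: "\<forall>x y. (x, y) \<notin> I \<longrightarrow> proj x y u = proj x y v"
  then have "word_le I u v" "word_le I v u" by (auto simp: word_le_def)
  then show "trace_eq I u v" using word_le_length word_le_same_length by blast
qed (simp add: trace_eq_proj)

lemma trace_eq_append_cancel_left: "trace_eq I (w @ u) (w @ v) \<longleftrightarrow> trace_eq I u v"
  by (simp add: trace_eq_iff_proj)

lemma trace_eq_append_cancel_right: "trace_eq I (u @ w) (v @ w) \<longleftrightarrow> trace_eq I u v"
  by (simp add: trace_eq_iff_proj)

section \<open>Least upper bounds of words with a common multiple\<close>

text \<open>For \<open>b\<close> dependent on \<open>a\<close>, \<open>proj a b v\<close> is a
  nonempty prefix of a word that starts with \<open>a\<close>. Together with
  \<open>indep_of_not_mem\<close> this gives a dichotomy: \<open>a\<close> divides \<open>v\<close>,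
  or it commutes with every letter of \<open>v\<close>.\<close>

lemma word_le_letter_of_mem:
  assumes a: "word_le I (a # u) t" and v: "word_le I v t" and "a \<in> set v"
  shows "word_le I [a] v"
  unfolding word_le_def
proof (intro allI impI)
  fix x y assume xy: "(x, y) \<notin> I"
  have *: "prefix [a] (proj a b v)" if ab: "(a, b) \<notin> I" for b
  proof -
    obtain s where "proj a b t = a # s" using hd_proj_of_letter_le[OF a ab] by blast
    moreover have "prefix (proj a b v) (proj a b t)" using v ab by (rule word_leD)
    moreover obtain c s' where "proj a b v = c # s'"
      using \<open>a \<in> set v\<close> by (cases "proj a b v") auto
    ultimately show ?thesis by simp
  qed
  show "prefix (proj x y [a]) (proj x y v)"
    using *[of x] *[of y] xy indep_sym[of y x] proj_commute[of y x v] by (cases "a = x"; cases "a = y") auto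
qed

text \<open>If \<open>a\<close> and \<open>b\<close> were dependent, \<open>proj a b v\<close> would
  be a nonempty prefix of a word starting with \<open>a\<close>, so \<open>a\<close> would occur in
  \<open>v\<close>.\<close>

lemma indep_of_not_mem:
  assumes a: "word_le I (a # u) t" and v: "word_le I v t" and "a \<notin> set v" and "b \<in> set v"
  shows "(a, b) \<in> I"
proof (rule ccontr)
  assume ab: "(a, b) \<notin> I"
  obtain s where "proj a b t = a # s" using hd_proj_of_letter_le[OF a ab] by blast
  moreover have "prefix (proj a b v) (proj a b t)" using v ab by (rule word_leD)
  moreover obtain c s' where c: "proj a b v = c # s'"
    using \<open>b \<in> set v\<close> by (cases "proj a b v") auto
  ultimately have "c = a" by simp
  then have "a \<in> set (proj a b v)" by (simp add: c)
  then show False using assms by simp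
qed

text \<open>A dependent pair that contains \<open>a\<close> misses \<open>v\<close> entirely, so the
  extra \<open>a\<close> only changes projections on which \<open>v\<close> is empty.\<close>

lemma word_le_Cons_indep:
  assumes "\<And>b. b \<in> set v \<Longrightarrow> (a, b) \<in> I"
  shows "word_le I v (a # s) \<longleftrightarrow> word_le I v s"
proof -
  have "prefix (proj x y v) (proj x y (a # s)) \<longleftrightarrow> prefix (proj x y v) (proj x y s)"
    if xy: "(x, y) \<notin> I" for x y
  proof (cases "a = x \<or> a = y")
    case True
    then have "x \<notin> set v" "y \<notin> set v"
      using assms[of x] assms[of y] xy indep_sym not_indep_refl by blast+
    then have "proj x y v = []" by simp
    then show ?thesis unfolding \<open>proj x y v = []\<close> by simp
  qed simp
  then show ?thesis by (simp add: word_le_def)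
qed

text \<open>Induction on \<open>u = a # u'\<close>. If \<open>a\<close> divides \<open>v\<close>, it
  is removed from \<open>u\<close>, \<open>v\<close> and every upper bound. Otherwise
  \<open>a\<close> commutes with all of \<open>v\<close>, and removing it from an upper bound leaves
  a multiple of \<open>v\<close>. The length estimate later confines the search for \<open>w\<close>
  to a finite set.\<close>

lemma word_lub:
  assumes "word_le I u t" "word_le I v t"
  shows "\<exists>w. word_le I u w \<and> word_le I v w \<and> length w \<le> length u + length v \<and>
    (\<forall>t'. word_le I u t' \<longrightarrow> word_le I v t' \<longrightarrow> word_le I w t')"
  using assms
proof (induction u arbitrary: v t)
  case Nil
  then show ?case by (intro exI[of _ v]) (auto simp: word_le_def)
next
  case (Cons a u)
  have split: "\<exists>s. trace_eq I t' (a # s)" if "word_le I [a] t'" for t'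
    using that trace_eq.sym by (fastforce simp: word_le_iff)
  have a_le: "word_le I [a] t'" if "word_le I (a # u) t'" for t'
    using that word_le_trans[of I "[a]" "a # u" t'] word_le_append[of I "[a]" u] by simp
  obtain t1 where t1: "trace_eq I t (a # t1)" using split a_le Cons.prems by blast
  have u1: "word_le I u t1"
    using word_le_trans[OF Cons.prems(1) trace_eq_word_le[OF t1]] by simp
  have v1: "word_le I v (a # t1)"
    using word_le_trans[OF Cons.prems(2) trace_eq_word_le[OF t1]] .
  show ?case
  proof (cases "word_le I [a] v")
    case True
    then obtain v' where v': "trace_eq I v (a # v')" using split by blast
    have "word_le I v' t1"
      using word_le_trans[OF trace_eq_word_le[OF trace_eq.sym[OF v']] v1] by simp
    from Cons.IH[OF u1 this] obtain w where w: "word_le I u w" "word_le I v' w"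
      "length w \<le> length u + length v'"
      "\<And>t'. word_le I u t' \<Longrightarrow> word_le I v' t' \<Longrightarrow> word_le I w t'" by blast
    show ?thesis
    proof (intro exI[of _ "a # w"] conjI allI impI)
      show "word_le I v (a # w)"
        using word_le_trans[OF trace_eq_word_le[OF v'], of "a # w"] w(2) by simp
      show "length (a # w) \<le> length (a # u) + length v"
        using w(3) trace_eq_length[OF v'] by simp
      fix t' assume t': "word_le I (a # u) t'" "word_le I v t'"
      obtain s where s: "trace_eq I t' (a # s)" using split a_le t' by blast
      have "word_le I u s"
        using word_le_trans[OF t'(1) trace_eq_word_le[OF s]] by simp
      moreover have "word_le I v' s"
        using word_le_trans[OF trace_eq_word_le[OF trace_eq.sym[OF v']]
          word_le_trans[OF t'(2) trace_eq_word_le[OF s]]] by simp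
      ultimately have "word_le I (a # w) (a # s)" using w(4) by simp
      then show "word_le I (a # w) t'"
        using word_le_trans[OF _ trace_eq_word_le[OF trace_eq.sym[OF s]]] by blast
    qed (use w in simp)
  next
    case False
    then have "a \<notin> set v" using word_le_letter_of_mem Cons.prems by blast
    then have ind: "\<And>b. b \<in> set v \<Longrightarrow> (a, b) \<in> I"
      using indep_of_not_mem Cons.prems by blast
    have "word_le I v t1" using v1 word_le_Cons_indep[OF ind] by blast
    from Cons.IH[OF u1 this] obtain w where w: "word_le I u w" "word_le I v w"
      "length w \<le> length u + length v"
      "\<And>t'. word_le I u t' \<Longrightarrow> word_le I v t' \<Longrightarrow> word_le I w t'" by blast
    show ?thesis
    proof (intro exI[of _ "a # w"] conjI allI impI)
      show "word_le I v (a # w)" using w(2) word_le_Cons_indep[OF ind] by blast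
      fix t' assume t': "word_le I (a # u) t'" "word_le I v t'"
      obtain s where s: "trace_eq I t' (a # s)" using split a_le t' by blast
      have "word_le I u s"
        using word_le_trans[OF t'(1) trace_eq_word_le[OF s]] by simp
      moreover have "word_le I v s"
        using word_le_trans[OF t'(2) trace_eq_word_le[OF s]] word_le_Cons_indep[OF ind] by blast
      ultimately have "word_le I (a # w) (a # s)" using w(4) by simp
      then show "word_le I (a # w) t'"
        using word_le_trans[OF _ trace_eq_word_le[OF trace_eq.sym[OF s]]] by blast
    qed (use w in simp_all)
  qed
qed

section \<open>Cliques as sets of pairwise independent letters\<close>

lemma letters_le_indep:
  assumes "word_le I [a] t" "word_le I [b] t" "a \<noteq> b"
  shows "(a, b) \<in> I"
  using indep_of_not_mem[OF assms(1,2)] assms(3) by simp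

definition clique_word :: "'a list \<Rightarrow> bool" where
  "clique_word w \<longleftrightarrow> (\<forall>i<length w. \<forall>j<length w. i \<noteq> j \<longrightarrow> (w ! i, w ! j) \<in> I)"

lemma clique_word_distinct: "clique_word w \<Longrightarrow> distinct w"
  unfolding clique_word_def distinct_conv_nth by (metis not_indep_refl)

lemma clique_word_iff:
  "clique_word w \<longleftrightarrow> distinct w \<and> (\<forall>a\<in>set w. \<forall>b\<in>set w. a \<noteq> b \<longrightarrow> (a, b) \<in> I)"
proof
  assume w: "clique_word w"
  then show "distinct w \<and> (\<forall>a\<in>set w. \<forall>b\<in>set w. a \<noteq> b \<longrightarrow> (a, b) \<in> I)"
    using clique_word_distinct[OF w] unfolding clique_word_def by (metis in_set_conv_nth)
next
  assume "distinct w \<and> (\<forall>a\<in>set w. \<forall>b\<in>set w. a \<noteq> b \<longrightarrow> (a, b) \<in> I)"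
  then show "clique_word w" unfolding clique_word_def by (simp add: nth_eq_iff_index_eq)
qed

lemma proj_clique_word:
  assumes "clique_word w" "(x, y) \<notin> I"
  shows "proj x y w = [] \<or> proj x y w = [x] \<or> proj x y w = [y]"
proof -
  have d: "distinct (proj x y w)"
    using clique_word_distinct[OF assms(1)] by (simp add: proj_def)
  have "\<not> (x \<in> set w \<and> y \<in> set w \<and> x \<noteq> y)"
    using assms by (auto simp: clique_word_iff)
  then have "set (proj x y w) = {} \<or> set (proj x y w) = {x} \<or> set (proj x y w) = {y}"
    by auto
  moreover have "proj x y w = [c]" if "set (proj x y w) = {c}" for c
    using d that by (cases "proj x y w"; cases "tl (proj x y w)") auto
  ultimately show ?thesis by (metis set_empty)
qed

text \<open>Every projection of a clique to a dependent pair has at most one letter, so divisibility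
  can be tested letter by letter. A clique is thus the join of its letters.\<close>

lemma clique_word_le_iff:
  assumes w: "clique_word w"
  shows "word_le I w t \<longleftrightarrow> (\<forall>a\<in>set w. word_le I [a] t)"
proof
  assume le: "word_le I w t"
  show "\<forall>a\<in>set w. word_le I [a] t"
  proof
    fix a assume a: "a \<in> set w"
    have "word_le I [a] w"
      unfolding word_le_def
    proof (intro allI impI)
      fix x y assume xy: "(x, y) \<notin> I"
      show "prefix (proj x y [a]) (proj x y w)"
      proof (cases "a = x \<or> a = y")
        case True
        then have "a \<in> set (proj x y w)" using a by simp
        then have "proj x y w = [a]"
          using proj_clique_word[OF w xy] by fastforce
        then show ?thesis using True by simp
      qed auto
    qed
    then show "word_le I [a] t" using le word_le_trans by blast
  qed
next
  assume *: "\<forall>a\<in>set w. word_le I [a] t"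
  show "word_le I w t"
    unfolding word_le_def
  proof (intro allI impI)
    fix x y assume xy: "(x, y) \<notin> I"
    have "prefix [a] (proj x y t)" if "proj x y w = [a]" for a
    proof -
      have "a \<in> set (proj x y w)" using that by simp
      then have "a \<in> set w" "a = x \<or> a = y" by auto
      then have "prefix (proj x y [a]) (proj x y t)" using * word_leD[OF _ xy, of "[a]" t] by blast
      then show ?thesis using \<open>a = x \<or> a = y\<close> by auto
    qed
    then show "prefix (proj x y w) (proj x y t)"
      using proj_clique_word[OF w xy] Nil_prefix by metis
  qed
qed

lemma clique_word_trace_eq_iff:
  assumes "clique_word v" "clique_word w"
  shows "trace_eq I v w \<longleftrightarrow> set v = set w"
proof
  assume eq: "set v = set w"
  have "word_le I v w" "word_le I w v"
    using clique_word_le_iff[OF assms(1), of w] clique_word_le_iff[OF assms(2), of w]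
      clique_word_le_iff[OF assms(1), of v] clique_word_le_iff[OF assms(2), of v] eq by auto
  then show "trace_eq I v w" using word_le_length word_le_same_length by blast
qed (rule trace_eq_set)

section \<open>Suffixes that follow a walk in the dependence graph\<close>

text \<open>Two prefixes of \<open>t\<close> are comparable. If \<open>q\<close> were strictly
  shorter, the missing tail of \<open>p\<close> would contain \<open>last p\<close>, and
  \<open>p\<close> would have more occurrences of it than \<open>q\<close>.\<close>

lemma prefix_of_last_count:
  assumes "prefix p t" "prefix q t" "p \<noteq> []" "count_list p (last p) \<le> count_list q (last p)"
  shows "prefix p q"
proof (rule ccontr)
  assume "\<not> prefix p q"
  then have "prefix q p" "q \<noteq> p" using assms(1,2) prefix_same_cases by blast+
  then obtain s where s: "p = q @ s" "s \<noteq> []" by (auto simp: prefix_def)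
  then have "last p \<in> set s" by simp
  then have "count_list s (last p) > 0" by (simp add: count_list_0_iff zero_less_iff_neq_zero)
  then show False using assms(4) s by simp
qed

text \<open>All of \<open>u @ w\<close> lies causally below its last letter, so \<open>u @ w\<close> is the
  least prefix of \<open>t\<close> that has the right number of occurrences of that letter.\<close>

lemma chain_suffix_le:
  assumes chain: "successively (\<lambda>x y. (x, y) \<notin> I) w" and "w \<noteq> []"
    and letters: "set u \<subseteq> set w" "set v \<subseteq> set w"
    and le: "word_le I (u @ w) t" "word_le I (v @ w) t"
    and cnt: "count_list u (last w) \<le> count_list v (last w)"
  shows "word_le I (u @ w) (v @ w)"
proof -
  have step: "prefix (proj x y (u @ w)) (proj x y (v @ w))"
    if xy: "(x, y) \<notin> I" and mem: "x \<in> set w \<or> y \<in> set w"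
      and c: "count_list u (last (proj x y w)) \<le> count_list v (last (proj x y w))" for x y
  proof (rule prefix_of_last_count)
    show "prefix (proj x y (u @ w)) (proj x y t)" "prefix (proj x y (v @ w)) (proj x y t)"
      using word_leD[OF le(1) xy] word_leD[OF le(2) xy] .
    have ne: "proj x y w \<noteq> []" using mem by auto
    then have l: "last (proj x y w) = x \<or> last (proj x y w) = y"
      using last_in_set[of "proj x y w"] by auto
    show "proj x y (u @ w) \<noteq> []" using ne by auto
    show "count_list (proj x y (u @ w)) (last (proj x y (u @ w)))
      \<le> count_list (proj x y (v @ w)) (last (proj x y (u @ w)))"
      using c ne l by (simp add: count_list_proj)
  qed
  \<comment> \<open>The count inequality travels along the walk from its end. At the last occurrence
    of \<open>x\<close>, the next letter \<open>y\<close> depends on \<open>x\<close> and ends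
    \<open>proj x y w\<close>; the inequality for \<open>y\<close> therefore settles this
    projection, and with it the count of \<open>x\<close>.\<close>
  have count: "\<forall>x\<in>set w2. count_list u x \<le> count_list v x" if "w = w1 @ w2" for w1 w2
    using that
  proof (induction w2 arbitrary: w1)
    case (Cons x w3)
    note w = Cons.prems
    have IH: "\<forall>x\<in>set w3. count_list u x \<le> count_list v x"
      using Cons.IH[of "w1 @ [x]"] w by simp
    moreover have "count_list u x \<le> count_list v x" if x: "x \<notin> set w3"
    proof (cases w3)
      case Nil
      then show ?thesis using cnt w by simp
    next
      case w3: (Cons y w4)
      have xy: "(x, y) \<notin> I"
        using chain w unfolding w3 by (simp add: successively_append_iff)
      have ne: "proj x y w3 \<noteq> []" using w3 by simp
      then have "last (proj x y w3) \<in> set (proj x y w3)" by (rule last_in_set)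
      then have "last (proj x y w3) = y" using x by auto
      then have l: "last (proj x y w) = y" using w ne by auto
      have "prefix (proj x y (u @ w)) (proj x y (v @ w))"
        using xy l IH w3 w by (intro step) auto
      then obtain s where "proj x y (v @ w) = proj x y (u @ w) @ s" by (auto simp: prefix_def)
      then have "count_list (proj x y (v @ w)) x = count_list (proj x y (u @ w)) x + count_list s x"
        by (simp del: proj_append)
      then show ?thesis by (simp add: count_list_proj)
    qed
    ultimately show ?case by auto
  qed simp
  show ?thesis
    unfolding word_le_def
  proof (intro allI impI)
    fix x y assume xy: "(x, y) \<notin> I"
    show "prefix (proj x y (u @ w)) (proj x y (v @ w))"
    proof (cases "x \<in> set w \<or> y \<in> set w")
      case True
      then have "proj x y w \<noteq> []" by auto
      then have "last (proj x y w) \<in> set (proj x y w)" by (rule last_in_set)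
      then have "last (proj x y w) \<in> set w" by auto
      then show ?thesis using step[OF xy True] count[of "[]" w] by simp
    next
      case False
      then have "proj x y (u @ w) = []" using letters by auto
      then show ?thesis by (simp only: Nil_prefix)
    qed
  qed
qed

text \<open>The counts of \<open>last w\<close> in \<open>u\<close> and \<open>v\<close> are
  comparable, so one of \<open>u @ w\<close> and \<open>v @ w\<close> lies below the other. Equal
  lengths make them equivalent, and \<open>w\<close> cancels.\<close>

lemma chain_suffix_inj:
  assumes chain: "successively (\<lambda>x y. (x, y) \<notin> I) w" and "w \<noteq> []"
    and letters: "set u \<subseteq> set w" "set v \<subseteq> set w"
    and le: "word_le I (u @ w) t" "word_le I (v @ w) t"
    and len: "length u = length v"
  shows "trace_eq I u v"
proof (cases "count_list u (last w) \<le> count_list v (last w)")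
  case True
  then have "word_le I (u @ w) (v @ w)" using chain_suffix_le assms by blast
  then show ?thesis
    using word_le_same_length[of "u @ w" "v @ w"] len by (simp add: trace_eq_append_cancel_right)
next
  case False
  then have "word_le I (v @ w) (u @ w)" using chain_suffix_le[of w v u t] assms by simp
  then show ?thesis
    using word_le_same_length[of "v @ w" "u @ w"] len
    by (simp add: trace_eq_append_cancel_right trace_eq.sym)
qed

end

lemma rtrancl_extend_successively:
  assumes "(b, a) \<in> R\<^sup>*" "w \<noteq> []" "last w = b" "successively (\<lambda>x y. (x, y) \<in> R) w"
  shows "\<exists>w'. successively (\<lambda>x y. (x, y) \<in> R) (w @ w') \<and> last (w @ w') = a"
  using assms
proof (induction rule: rtrancl_induct)
  case base
  then show ?case by (intro exI[of _ "[]"]) auto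
next
  case (step y z)
  then obtain w' where "successively (\<lambda>x y. (x, y) \<in> R) (w @ w')" "last (w @ w') = y" by blast
  then have "successively (\<lambda>x y. (x, y) \<in> R) (w @ w' @ [z])"
    using step.hyps step.prems successively_append_iff[of _ "w @ w'" "[z]"] by simp
  then show ?case by (intro exI[of _ "w' @ [z]"]) auto
qed

text \<open>Induction on \<open>F\<close>: a path from the current endpoint to the new letter is
  appended. The endpoint is kept in \<open>S\<close> so that connectivity applies to it.\<close>

lemma exists_covering_walk:
  assumes fin: "finite F" and sub: "F \<subseteq> S" and S: "S \<noteq> {}" and R: "R \<subseteq> S \<times> S"
    and conn: "\<forall>a\<in>S. \<forall>b\<in>S. (a, b) \<in> R\<^sup>*"
  shows "\<exists>w. w \<noteq> [] \<and> last w \<in> S \<and> F \<subseteq> set w \<and> successively (\<lambda>x y. (x, y) \<in> R) w"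
  using fin sub
proof (induction rule: finite_induct)
  case empty
  obtain a where "a \<in> S" using S by blast
  then show ?case by (intro exI[of _ "[a]"]) auto
next
  case (insert x F)
  then obtain w where w: "w \<noteq> []" "last w \<in> S" "F \<subseteq> set w" "successively (\<lambda>x y. (x, y) \<in> R) w"
    by auto
  have "(last w, x) \<in> R\<^sup>*" using conn w insert.prems by auto
  from rtrancl_extend_successively[OF this w(1) HOL.refl w(4)] obtain w' where
    w': "successively (\<lambda>x y. (x, y) \<in> R) (w @ w')" "last (w @ w') = x" by blast
  have "x \<in> set (w @ w')" using w' w(1) last_in_set[of "w @ w'"] by simp
  then show ?case using w w' insert.prems by (intro exI[of _ "w @ w'"]) auto
qed

section \<open>Extending finitely additive measures on cylinders\<close>

text \<open>Membership depends on the finitely many coordinates in \<open>F\<close>; one implication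
  expresses this, as \<open>x\<close> and \<open>y\<close> can be exchanged.\<close>

definition cylinder :: "('b \<Rightarrow> bool) set \<Rightarrow> bool" where
  "cylinder A \<longleftrightarrow> (\<exists>F. finite F \<and> (\<forall>x y. (\<forall>i\<in>F. x i = y i) \<longrightarrow> x \<in> A \<longrightarrow> y \<in> A))"

lemma cylinderI:
  assumes "finite F" "\<And>x y. (\<And>i. i \<in> F \<Longrightarrow> x i = y i) \<Longrightarrow> x \<in> A \<Longrightarrow> y \<in> A"
  shows "cylinder A"
  using assms unfolding cylinder_def by blast

lemma algebra_cylinder: "algebra UNIV {A :: ('b \<Rightarrow> bool) set. cylinder A}"
  unfolding algebra_iff_Un
proof (intro conjI ballI)
  show "{} \<in> {A :: ('b \<Rightarrow> bool) set. cylinder A}" by (auto intro: cylinderI[of "{}"])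
next
  fix A :: "('b \<Rightarrow> bool) set" assume "A \<in> {A. cylinder A}"
  then obtain F where F: "finite F" "\<And>x y. (\<forall>i\<in>F. x i = y i) \<Longrightarrow> x \<in> A \<Longrightarrow> y \<in> A"
    by (auto simp: cylinder_def)
  show "UNIV - A \<in> {A. cylinder A}"
  proof (simp, rule cylinderI[OF F(1)])
    fix x y assume *: "\<And>i. i \<in> F \<Longrightarrow> x i = y i" "x \<in> UNIV - A"
    show "y \<in> UNIV - A" using F(2)[of y x] * by auto
  qed
next
  fix A B :: "('b \<Rightarrow> bool) set" assume "A \<in> {A. cylinder A}" "B \<in> {A. cylinder A}"
  then obtain F G where F: "finite F" "\<And>x y. (\<forall>i\<in>F. x i = y i) \<Longrightarrow> x \<in> A \<Longrightarrow> y \<in> A"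
    and G: "finite G" "\<And>x y. (\<forall>i\<in>G. x i = y i) \<Longrightarrow> x \<in> B \<Longrightarrow> y \<in> B"
    by (auto simp: cylinder_def)
  show "A \<union> B \<in> {A. cylinder A}"
  proof (simp, rule cylinderI[of "F \<union> G"])
    fix x y assume *: "\<And>i. i \<in> F \<union> G \<Longrightarrow> x i = y i" "x \<in> A \<union> B"
    show "y \<in> A \<union> B" using F(2)[of x y] G(2)[of x y] * by auto
  qed (use F G in simp)
qed simp

lemma cylinder_Compl:
  fixes A :: "('b \<Rightarrow> bool) set"
  shows "cylinder A \<Longrightarrow> cylinder (- A)"
  using algebra_cylinder[where 'b = 'b] unfolding algebra_iff_Un by (simp add: Compl_eq_Diff_UNIV)

text \<open>The set is the union, over its points, of the basic neighbourhoods that fix the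
  coordinates in \<open>F\<close>. As complements of cylinders are cylinders, all of them are
  clopen.\<close>

lemma open_cylinder:
  fixes A :: "('b \<Rightarrow> bool) set"
  assumes "cylinder A" shows "open A"
proof -
  obtain F where F: "finite F" "\<And>x y. (\<forall>i\<in>F. x i = y i) \<Longrightarrow> x \<in> A \<Longrightarrow> y \<in> A"
    using assms by (auto simp: cylinder_def)
  have "A = (\<Union>x\<in>A. \<Inter>i\<in>F. (\<lambda>y. y i) -` {x i})"
  proof (intro equalityI subsetI)
    fix y assume "y \<in> (\<Union>x\<in>A. \<Inter>i\<in>F. (\<lambda>y. y i) -` {x i})"
    then obtain x where "x \<in> A" "\<forall>i\<in>F. y i = x i" by auto
    then show "y \<in> A" using F(2)[of x y] by auto
  qed auto
  moreover have "open (\<Inter>i\<in>F. (\<lambda>y :: 'b \<Rightarrow> bool. y i) -` {x i})" for x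
  proof (intro open_INT F(1) ballI)
    fix i
    have "open {x i}" by (rule discrete_topology_class.open_discrete)
    then show "open ((\<lambda>y :: 'b \<Rightarrow> bool. y i) -` {x i})"
      by (rule open_vimage[OF _ continuous_on_product_coordinates])
  qed
  ultimately show ?thesis by (metis (no_types, lifting) open_UN)
qed

text \<open>Tychonoff's theorem for finite factors.\<close>

lemma compact_UNIV_fun: "compact (UNIV :: ('b \<Rightarrow> 'c :: {finite, topological_space}) set)"
proof -
  have "compactin (product_topology (\<lambda>_. euclidean) UNIV)
      (PiE (UNIV :: 'b set) (\<lambda>_. UNIV :: 'c set))"
    unfolding compactin_PiE by (simp add: finite_imp_compact)
  then show ?thesis by (simp add: euclidean_product_topology PiE_UNIV_domain)
qed

text \<open>Caratheodory's theorem asks for continuity at the empty set. Cylinders are closed in a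
  compact space, so a decreasing sequence of them with empty intersection is eventually empty.
  Agreement with \<open>\<nu>\<close> is claimed on cylinders only.\<close>

lemma finitely_additive_extension:
  fixes \<nu> :: "('b \<Rightarrow> bool) set \<Rightarrow> real"
  assumes nonneg: "\<And>A. 0 \<le> \<nu> A"
    and add: "\<And>A B. A \<inter> B = {} \<Longrightarrow> \<nu> (A \<union> B) = \<nu> A + \<nu> B"
    and one: "\<nu> UNIV = 1"
  obtains N where "prob_space N" "space N = UNIV"
    "\<forall>A. cylinder A \<longrightarrow> A \<in> sets N \<and> measure N A = \<nu> A"
proof -
  let ?C = "{A :: ('b \<Rightarrow> bool) set. cylinder A}"
  interpret algebra UNIV ?C by (rule algebra_cylinder)
  have zero: "\<nu> {} = 0" using add[of "{}" "{}"] by simp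
  have "\<exists>\<mu> :: ('b \<Rightarrow> bool) set \<Rightarrow> ennreal. (\<forall>A\<in>?C. \<mu> A = ennreal (\<nu> A)) \<and>
      measure_space UNIV (sigma_sets UNIV ?C) \<mu>"
  proof (rule caratheodory_empty_continuous)
    show "positive ?C (\<lambda>A. ennreal (\<nu> A))" by (simp add: positive_def zero)
    show "additive ?C (\<lambda>A. ennreal (\<nu> A))" by (simp add: additive_def add nonneg)
    fix A :: "nat \<Rightarrow> ('b \<Rightarrow> bool) set"
    assume A: "range A \<subseteq> ?C" "decseq A" "(\<Inter>i. A i) = {}"
    have "\<exists>i. A i = {}"
    proof (rule ccontr)
      assume ne: "\<nexists>i. A i = {}"
      have "UNIV \<inter> (\<Inter>i\<in>UNIV. A i) \<noteq> {}"
      proof (rule compact_imp_fip_image[OF compact_UNIV_fun])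
        show "closed (A i)" for i
          using open_cylinder[OF cylinder_Compl] A(1) by (auto simp: closed_def)
        fix K :: "nat set" assume K: "finite K"
        have "A (Max (insert 0 K)) \<subseteq> A i" if "i \<in> K" for i
          using K that by (intro decseqD[OF A(2)] Max_ge) auto
        then show "UNIV \<inter> (\<Inter>i\<in>K. A i) \<noteq> {}" using ne by blast
      qed
      then show False using A(3) by simp
    qed
    then obtain i where "A i = {}" by blast
    then have "A j = {}" if "i \<le> j" for j using decseqD[OF A(2) that] by simp
    then have "eventually (\<lambda>j. ennreal (\<nu> (A j)) = 0) sequentially"
      unfolding eventually_sequentially using zero by (metis ennreal_0)
    then show "(\<lambda>j. ennreal (\<nu> (A j))) \<longlonglongrightarrow> 0" by (rule tendsto_eventually)
  qed simp
  then obtain \<mu> where \<mu>: "\<And>A. cylinder A \<Longrightarrow> \<mu> A = ennreal (\<nu> A)"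
    "measure_space UNIV (sigma_sets UNIV ?C) \<mu>" by blast
  define N where "N = measure_of UNIV (sigma_sets UNIV ?C) \<mu>"
  have N: "emeasure N A = ennreal (\<nu> A)" "A \<in> sets N" if "cylinder A" for A
  proof -
    have A: "A \<in> sigma_sets UNIV ?C" using that by (auto intro: sigma_sets.Basic)
    show "emeasure N A = ennreal (\<nu> A)"
      using \<mu>(2) A \<mu>(1)[OF that] unfolding N_def measure_space_def
      by (subst emeasure_measure_of_sigma) auto
    show "A \<in> sets N" using A by (simp add: N_def sigma_sets_sigma_sets_eq)
  qed
  have U: "cylinder (UNIV :: ('b \<Rightarrow> bool) set)" by (rule cylinderI[of "{}"]) auto
  have sp: "space N = UNIV" by (simp add: N_def)
  show ?thesis
  proof (rule that[of N])
    show "prob_space N" by (rule prob_spaceI) (simp add: sp N(1)[OF U] one)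
    show "\<forall>A. cylinder A \<longrightarrow> A \<in> sets N \<and> measure N A = \<nu> A"
      using N nonneg by (simp add: measure_def)
  qed (rule sp)
qed

text \<open>Set functions with values in \<open>{0..1}\<close> form a compact product space, so a
  cluster point exists without any convergence assumption. Each instance of additivity involves
  three coordinates and passes to the limit.\<close>

lemma finitely_additive_limit:
  fixes m :: "'i \<Rightarrow> 'x set \<Rightarrow> real"
  assumes F: "F \<noteq> bot"
    and ev: "eventually (\<lambda>i. (\<forall>A. 0 \<le> m i A \<and> m i A \<le> 1) \<and>
      (\<forall>A B. A \<inter> B = {} \<longrightarrow> m i (A \<union> B) = m i A + m i B)) F"
  obtains \<nu> where "\<forall>A. 0 \<le> \<nu> A" "\<forall>A B. A \<inter> B = {} \<longrightarrow> \<nu> (A \<union> B) = \<nu> A + \<nu> B"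
    "\<forall>A L. ((\<lambda>i. m i A) \<longlongrightarrow> L) F \<longrightarrow> \<nu> A = L"
proof -
  let ?K = "PiE UNIV (\<lambda>_. {0..1}) :: ('x set \<Rightarrow> real) set"
  have "compactin (product_topology (\<lambda>_. euclidean) UNIV) ?K"
    unfolding compactin_PiE by simp
  then have K: "compact ?K" by (simp add: euclidean_product_topology)
  define G where "G = filtermap m F"
  have "eventually (\<lambda>g. g \<in> ?K) G"
    unfolding G_def eventually_filtermap using ev by eventually_elim auto
  moreover have "G \<noteq> bot" using F by (simp add: G_def filtermap_bot_iff)
  ultimately obtain \<nu> where \<nu>: "\<nu> \<in> ?K" "inf (nhds \<nu>) G \<noteq> bot"
    using K unfolding compact_filter by blast
  \<comment> \<open>\<open>H\<close> turns the cluster point into a limit, and being finer than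
    \<open>G\<close> it keeps everything that holds eventually along \<open>F\<close>.\<close>
  define H where "H = inf (nhds \<nu>) G"
  have H: "H \<noteq> bot" "H \<le> nhds \<nu>" "H \<le> G" using \<nu>(2) by (auto simp: H_def)
  have lim: "((\<lambda>g. g A) \<longlongrightarrow> \<nu> A) H" for A
  proof -
    have "((\<lambda>g. g A) \<longlongrightarrow> \<nu> A) (nhds \<nu>)"
    proof (rule topological_tendstoI)
      fix U assume "open U" "\<nu> A \<in> U"
      then show "eventually (\<lambda>g. g A \<in> U) (nhds \<nu>)"
        unfolding eventually_nhds
        using open_vimage[OF _ continuous_on_product_coordinates, of U A]
        by (intro exI[of _ "(\<lambda>g. g A) -` U"]) auto
    qed
    then show ?thesis using H(2) tendsto_mono by blast
  qed
  show ?thesis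
  proof (rule that[of \<nu>])
    show "\<forall>A. 0 \<le> \<nu> A" using \<nu>(1) by (auto simp: PiE_iff)
    show "\<forall>A B. A \<inter> B = {} \<longrightarrow> \<nu> (A \<union> B) = \<nu> A + \<nu> B"
    proof (intro allI impI)
      fix A B :: "'x set" assume AB: "A \<inter> B = {}"
      have "eventually (\<lambda>g. g (A \<union> B) = g A + g B) G"
        unfolding G_def eventually_filtermap using ev by eventually_elim (use AB in blast)
      then have "eventually (\<lambda>g. g (A \<union> B) = g A + g B) H" using H(3) filter_leD by blast
      moreover have "((\<lambda>g. g A + g B) \<longlongrightarrow> \<nu> A + \<nu> B) H" by (intro tendsto_add lim)
      ultimately have "((\<lambda>g. g (A \<union> B)) \<longlongrightarrow> \<nu> A + \<nu> B) H"
        by (subst tendsto_cong)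
      then show "\<nu> (A \<union> B) = \<nu> A + \<nu> B" using lim[of "A \<union> B"] tendsto_unique[OF H(1)] by blast
    qed
    show "\<forall>A L. ((\<lambda>i. m i A) \<longlongrightarrow> L) F \<longrightarrow> \<nu> A = L"
    proof (intro allI impI)
      fix A L assume "((\<lambda>i. m i A) \<longlongrightarrow> L) F"
      then have "((\<lambda>g. g A) \<longlongrightarrow> L) G" by (simp add: G_def filterlim_filtermap)
      then have "((\<lambda>g. g A) \<longlongrightarrow> L) H" using H(3) tendsto_mono by blast
      then show "\<nu> A = L" using lim[of A] tendsto_unique[OF H(1)] by blast
    qed
  qed
qed

section \<open>Linear recurrences\<close>

text \<open>This is \<open>q(E) y\<close> for the shift \<open>E\<close>; its vanishing is the
  linear recurrence with characteristic polynomial \<open>q\<close>.\<close>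

definition shift_op :: "complex poly \<Rightarrow> (nat \<Rightarrow> complex) \<Rightarrow> nat \<Rightarrow> complex" where
  "shift_op q y n = (\<Sum>i\<le>degree q. coeff q i * y (n + i))"

lemma shift_op_altdef:
  assumes "degree q \<le> N" shows "shift_op q y n = (\<Sum>i\<le>N. coeff q i * y (n + i))"
  unfolding shift_op_def using assms
  by (intro sum.mono_neutral_left) (auto simp: coeff_eq_0)

lemma shift_op_add: "shift_op (p + q) y n = shift_op p y n + shift_op q y n"
proof -
  let ?N = "max (degree p) (degree q)"
  have "degree (p + q) \<le> ?N" by (rule degree_add_le_max)
  then show ?thesis
    by (simp add: shift_op_altdef[of _ ?N] sum.distrib algebra_simps)
qed

lemma shift_op_0 [simp]: "shift_op 0 y n = 0"
  by (simp add: shift_op_def)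

lemma shift_op_sum: "finite A \<Longrightarrow> shift_op (\<Sum>c\<in>A. f c) y n = (\<Sum>c\<in>A. shift_op (f c) y n)"
  by (induction A rule: finite_induct) (auto simp: shift_op_add)

lemma shift_op_monom: "shift_op (monom a k) y n = a * y (n + k)"
proof -
  have "shift_op (monom a k) y n = (\<Sum>i\<le>k. if k = i then a * y (n + i) else 0)"
    unfolding shift_op_altdef[OF degree_monom_le]
    by (intro sum.cong) auto
  then show ?thesis by (simp add: eq_commute)
qed

text \<open>The factorization \<open>q(E) (E - w)\<close>, which lowers the order of a recurrence by
  one.\<close>

lemma shift_op_linear_factor:
  "shift_op ([:- w, 1:] * q) y n = shift_op q (\<lambda>n. y (Suc n) - w * y n) n"
proof -
  have "[:- w, 1:] * q = (\<Sum>i\<le>degree q. monom (coeff q i) (Suc i) + monom (- w * coeff q i) i)"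
    (is "_ = sum ?f _")
  proof -
    have "[:- w, 1:] * q = pCons 0 q + smult (- w) q" by simp
    also have "pCons 0 q = (\<Sum>i\<le>degree q. monom (coeff q i) (Suc i))"
      by (subst poly_as_sum_of_monoms[of q, symmetric])
        (simp add: monom_Suc poly_eq_iff coeff_sum coeff_pCons split: nat.splits)
    also have "smult (- w) q = (\<Sum>i\<le>degree q. monom (- w * coeff q i) i)"
      using poly_as_sum_of_monoms'[OF degree_smult_le[of "- w" q]] by simp
    finally show ?thesis by (simp add: sum.distrib)
  qed
  then show ?thesis
    by (simp add: shift_op_sum shift_op_add shift_op_monom sum.distrib[symmetric])
      (simp add: shift_op_def algebra_simps)
qed

text \<open>Dividing by \<open>cmod w ^ n\<close> bounds \<open>cmod x0\<close> by a null
  sequence.\<close>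

lemma geometric_dominated_imp_zero:
  fixes w p x0 :: complex
  assumes "cmod p < cmod w" and "\<And>n. cmod (w ^ n * x0) \<le> C * cmod p ^ n"
  shows "x0 = 0"
proof (rule ccontr)
  assume x0: "x0 \<noteq> 0"
  have w: "0 < cmod w" using assms(1) norm_ge_zero[of p] by linarith
  have "(\<lambda>n. C * (cmod p / cmod w) ^ n) \<longlonglongrightarrow> C * 0"
    using assms(1) w by (intro tendsto_mult tendsto_const LIMSEQ_realpow_zero) auto
  moreover have "cmod x0 \<le> C * (cmod p / cmod w) ^ n" for n
    using assms(2)[of n] w by (simp add: norm_mult norm_power power_divide field_simps)
  ultimately have "cmod x0 \<le> 0" by (intro LIMSEQ_le_const) auto
  then show False using x0 by simp
qed

text \<open>Induction on the degree. For a root \<open>w\<close> of \<open>q\<close>, the sequence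
  \<open>(E - w) y\<close> satisfies the recurrence of the quotient and a bound of the same shape,
  so it is geometric with ratio \<open>p\<close>. Then \<open>(E - p) y\<close> is geometric with
  ratio \<open>w\<close>, and the bound on \<open>y\<close> forces it to vanish.\<close>

lemma recurrence_dominated_by_smallest_root:
  fixes p :: complex
  assumes "p \<noteq> 0" "q \<noteq> 0"
    and "\<And>w. poly q w = 0 \<Longrightarrow> w = p \<or> cmod p < cmod w"
    and "\<And>n. shift_op q y n = 0"
    and "\<And>n. cmod (y n) \<le> C * cmod p ^ n"
  shows "y (Suc n) = p * y n"
  using assms
proof (induction "degree q" arbitrary: q y C n)
  case 0
  then obtain a where "q = [:a:]" "a \<noteq> 0" by (metis degree_eq_zeroE pCons_eq_0_iff)
  then have "y n = 0" for n using 0(5)[of n] by (simp add: shift_op_def)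
  then show ?case by simp
next
  case (Suc d)
  obtain w where w: "poly q w = 0"
    using fundamental_theorem_of_algebra[of q] Suc.hyps(2) constant_degree[of q] by auto
  then obtain q' where q': "q = [:- w, 1:] * q'" using poly_eq_0_iff_dvd by blast
  have q'0: "q' \<noteq> 0" using q' Suc.prems by auto
  then have deg: "degree q' = d" using Suc.hyps(2) unfolding q' by (subst (asm) degree_mult_eq) auto
  define z where "z n = y (Suc n) - w * y n" for n
  have z: "z (Suc n) = p * z n" for n
  proof (rule Suc.hyps(1)[OF deg[symmetric] Suc.prems(1) q'0])
    show "w = p \<or> cmod p < cmod w" if "poly q' w = 0" for w
      using Suc.prems(3)[of w] that by (simp add: q')
    show "shift_op q' z n = 0" for n
      using Suc.prems(4)[of n] unfolding q' shift_op_linear_factor z_def .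
    show "cmod (z n) \<le> (C * cmod p + cmod w * C) * cmod p ^ n" for n
    proof -
      have "cmod (z n) \<le> cmod (y (Suc n)) + cmod w * cmod (y n)"
        unfolding z_def using norm_triangle_ineq4[of "y (Suc n)" "w * y n"] by (simp add: norm_mult)
      also have "\<dots> \<le> C * cmod p ^ Suc n + cmod w * (C * cmod p ^ n)"
        by (intro add_mono mult_left_mono Suc.prems(5)) auto
      finally show ?thesis by (simp add: algebra_simps)
    qed
  qed
  \<comment> \<open>Since \<open>E - p\<close> and \<open>E - w\<close> commute, the recursion for
    \<open>z\<close> becomes one for \<open>x\<close> with ratio \<open>w\<close>.\<close>
  define x where "x n = y (Suc n) - p * y n" for n
  have "x (Suc n) = w * x n" for n
    using z[of n] by (simp add: x_def z_def algebra_simps)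
  then have xn: "x n = w ^ n * x 0" for n by (induction n) auto
  have "x 0 = 0"
  proof (cases "w = p")
    case False
    then have lt: "cmod p < cmod w" using Suc.prems(3)[OF w] by auto
    have "cmod (w ^ n * x 0) \<le> (2 * C * cmod p) * cmod p ^ n" for n
    proof -
      have "cmod (x n) \<le> cmod (y (Suc n)) + cmod p * cmod (y n)"
        unfolding x_def using norm_triangle_ineq4[of "y (Suc n)" "p * y n"] by (simp add: norm_mult)
      also have "\<dots> \<le> C * cmod p ^ Suc n + cmod p * (C * cmod p ^ n)"
        by (intro add_mono mult_left_mono Suc.prems(5)) auto
      finally show ?thesis using xn[of n] by (simp add: algebra_simps)
    qed
    then show ?thesis using geometric_dominated_imp_zero[OF lt] by blast
  next
    case True
    \<comment> \<open>When \<open>w = p\<close>, the solution is \<open>p ^ n\<close> times a linear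
      function of \<open>n\<close>; the bound rules out a nonzero slope.\<close>
    have yn: "y n = p ^ n * (y 0 + of_nat n * (x 0 / p))" for n
    proof (induction n)
      case (Suc n)
      have "y (Suc n) = p * y n + x n" by (simp add: x_def)
      also have "\<dots> = p * (p ^ n * (y 0 + of_nat n * (x 0 / p))) + p ^ n * x 0"
        unfolding Suc using xn[of n] True by simp
      also have "\<dots> = p ^ Suc n * (y 0 + of_nat (Suc n) * (x 0 / p))"
        using Suc.prems \<open>p \<noteq> 0\<close> by (simp add: field_simps)
      finally show ?case .
    qed simp
    show ?thesis
    proof (rule ccontr)
      assume "x 0 \<noteq> 0"
      then have "cmod (x 0 / p) > 0" using Suc.prems(1) by simp
      then obtain n where n: "C + cmod (y 0) < of_nat n * cmod (x 0 / p)"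
        using reals_Archimedean3 by blast
      have "cmod p ^ n * cmod (y 0 + of_nat n * (x 0 / p)) \<le> C * cmod p ^ n"
        using Suc.prems(5)[of n] by (subst (asm) yn) (simp add: norm_mult norm_power)
      then have "cmod (y 0 + of_nat n * (x 0 / p)) \<le> C"
        using Suc.prems(1) by (simp add: mult.commute)
      moreover have "cmod (of_nat n * (x 0 / p)) - cmod (y 0) \<le> cmod (y 0 + of_nat n * (x 0 / p))"
        using norm_diff_ineq[of "of_nat n * (x 0 / p)" "y 0"] by (simp add: add.commute)
      ultimately show False using n by (simp add: norm_mult norm_divide)
    qed
  qed
  then have "x n = 0" using xn[of n] by simp
  then show ?case by (simp add: x_def)
qed

section \<open>The trace monoid\<close>

text \<open>Subsets without a fixed element \<open>x\<close> cancel against the same subsets with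
  \<open>x\<close> inserted.\<close>

lemma sum_alternating_Pow:
  assumes "finite A"
  shows "(\<Sum>B\<in>Pow A. (- 1) ^ card B) = (if A = {} then 1 else 0 :: 'c :: comm_ring_1)"
proof (cases "A = {}")
  case False
  then obtain x F where A: "A = insert x F" "x \<notin> F" by (meson mk_disjoint_insert ex_in_conv)
  then have F: "finite F" using assms by simp
  have inj: "inj_on (insert x) (Pow F)" using A by (auto simp: inj_on_def)
  have "(\<Sum>B\<in>Pow A. (- 1) ^ card B) =
      (\<Sum>B\<in>Pow F. (- 1) ^ card B) + (\<Sum>B\<in>insert x ` Pow F. (- 1) ^ card B :: 'c)"
    unfolding A Pow_insert using A F by (intro sum.union_disjoint) auto
  also have "(\<Sum>B\<in>insert x ` Pow F. (- 1) ^ card B :: 'c) = (\<Sum>B\<in>Pow F. - ((- 1) ^ card B))"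
    unfolding sum.reindex[OF inj] o_def
  proof (rule sum.cong)
    fix B assume "B \<in> Pow F"
    then have "finite B" "x \<notin> B" using F A finite_subset by auto
    then show "(- 1) ^ card (insert x B) = - ((- 1) ^ card B :: 'c)" by simp
  qed simp
  finally show ?thesis using False by (simp add: sum_negf)
qed simp

declare in_lists_conv_set [simp del] in_listsD [rule del] in_listsI [rule del]

locale trace_pair =
  fixes S :: "'a set" and I :: "('a \<times> 'a) set"
  assumes indep_pair: "independence_pair S I"
begin

sublocale independence I
  using indep_pair by unfold_locales (auto simp: independence_pair_def)

abbreviation "cls \<equiv> trace_of S I"
abbreviation "traces \<equiv> carrier (trace_monoid S I)"
abbreviation mul (infixl \<open>\<star>\<close> 70) where "u \<star> v \<equiv> u \<otimes>\<^bsub>trace_monoid S I\<^esub> v"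
abbreviation tle (infix \<open>\<unlhd>\<close> 50) where "u \<unlhd> v \<equiv> u divides\<^bsub>trace_monoid S I\<^esub> v"
abbreviation "unit_trace \<equiv> cls []"
abbreviation "len \<equiv> trace_length"

lemma finite_S: "finite S" and S_nonempty: "S \<noteq> {}"
  using indep_pair by (auto simp: independence_pair_def)

section \<open>Transfer from words to traces\<close>

lemma traces_eq: "traces = cls ` lists S"
  by (auto simp: trace_monoid_def quotient_def trace_of_def)

lemma cls_in_traces [simp]: "w \<in> lists S \<Longrightarrow> cls w \<in> traces"
  by (simp add: traces_eq)

lemma tracesE:
  assumes "u \<in> traces" obtains w where "w \<in> lists S" "u = cls w"
  using assms by (auto simp: traces_eq)

lemma cls_eq_iff:
  assumes "u \<in> lists S" "v \<in> lists S"
  shows "cls u = cls v \<longleftrightarrow> trace_eq I u v"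
  using eq_equiv_class_iff[OF equiv_trace_rel assms, of I] assms
  by (auto simp: trace_of_def trace_rel_def)

lemma cls_le_iff:
  assumes u: "u \<in> lists S" and v: "v \<in> lists S"
  shows "cls u \<unlhd> cls v \<longleftrightarrow> word_le I u v"
proof
  assume "cls u \<unlhd> cls v"
  then obtain z where z: "z \<in> lists S" "cls v = cls u \<star> cls z"
    by (auto simp: factor_def elim!: tracesE)
  then have "cls v = cls (u @ z)" using u by (simp add: trace_mult_trace_of)
  then have "trace_eq I v (u @ z)" using u v z by (subst (asm) cls_eq_iff) auto
  then show "word_le I u v" using word_le_iff trace_eq.sym by blast
next
  assume "word_le I u v"
  then obtain z where z: "trace_eq I (u @ z) v" by (auto simp: word_le_iff)
  \<comment> \<open>The cofactor is at first a word over the whole letter type; all its letters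
    occur in \<open>v\<close>, hence lie in \<open>S\<close>.\<close>
  then have zS: "z \<in> lists S" using trace_eq_set[OF z] v by (auto simp: in_lists_conv_set)
  then have "cls v = cls (u @ z)"
    using z u v trace_eq.sym by (subst cls_eq_iff) auto
  then show "cls u \<unlhd> cls v"
    using zS u by (intro dividesI[of "cls z"]) (auto simp: trace_mult_trace_of)
qed

lemma len_cls [simp]: "w \<in> lists S \<Longrightarrow> len (cls w) = length w"
  by (rule trace_length_trace_of)

lemma mul_cls [simp]: "u \<in> lists S \<Longrightarrow> v \<in> lists S \<Longrightarrow> cls u \<star> cls v = cls (u @ v)"
  by (rule trace_mult_trace_of)

lemma unit_closed [simp]: "unit_trace \<in> traces"
  by simp

lemma mul_closed [simp]: "u \<in> traces \<Longrightarrow> v \<in> traces \<Longrightarrow> u \<star> v \<in> traces"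
  by (elim tracesE) simp

lemma mul_assoc: "u \<in> traces \<Longrightarrow> v \<in> traces \<Longrightarrow> w \<in> traces \<Longrightarrow> u \<star> v \<star> w = u \<star> (v \<star> w)"
  by (elim tracesE) simp

lemma mul_unit [simp]: "u \<in> traces \<Longrightarrow> u \<star> unit_trace = u"
  by (elim tracesE) simp

lemma unit_mul [simp]: "u \<in> traces \<Longrightarrow> unit_trace \<star> u = u"
  by (elim tracesE) simp

lemma len_mul [simp]: "u \<in> traces \<Longrightarrow> v \<in> traces \<Longrightarrow> len (u \<star> v) = len u + len v"
  by (elim tracesE) simp

lemma len_eq_0_iff: "u \<in> traces \<Longrightarrow> len u = 0 \<longleftrightarrow> u = unit_trace"
  by (auto elim!: tracesE)

lemma le_refl [simp]: "u \<in> traces \<Longrightarrow> u \<unlhd> u"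
  by (elim tracesE) (simp add: cls_le_iff)

lemma le_trans: "u \<unlhd> v \<Longrightarrow> v \<unlhd> w \<Longrightarrow> u \<in> traces \<Longrightarrow> u \<unlhd> w"
  unfolding factor_def using mul_assoc by (metis mul_closed)

lemma unit_le [simp]: "u \<in> traces \<Longrightarrow> unit_trace \<unlhd> u"
  by (rule dividesI[of u]) auto

lemma le_mul [simp]: "u \<in> traces \<Longrightarrow> v \<in> traces \<Longrightarrow> u \<unlhd> u \<star> v"
  by (rule dividesI[of v]) auto

lemma le_len: "u \<unlhd> v \<Longrightarrow> u \<in> traces \<Longrightarrow> len u \<le> len v"
  by (auto simp: factor_def)

lemma le_len_eq: "u \<unlhd> v \<Longrightarrow> u \<in> traces \<Longrightarrow> len v \<le> len u \<Longrightarrow> u = v"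
  by (auto simp: factor_def len_eq_0_iff)

lemma mul_le_mul_iff [simp]:
  "u \<in> traces \<Longrightarrow> v \<in> traces \<Longrightarrow> w \<in> traces \<Longrightarrow> u \<star> v \<unlhd> u \<star> w \<longleftrightarrow> v \<unlhd> w"
  by (elim tracesE) (simp add: cls_le_iff)

lemma mul_left_cancel:
  "u \<in> traces \<Longrightarrow> v \<in> traces \<Longrightarrow> w \<in> traces \<Longrightarrow> u \<star> v = u \<star> w \<longleftrightarrow> v = w"
  by (elim tracesE) (simp add: cls_eq_iff trace_eq_append_cancel_left)

lemma trace_lub:
  assumes "u \<in> traces" "v \<in> traces" "t \<in> traces" "u \<unlhd> t" "v \<unlhd> t"
  obtains w where "w \<in> traces" "u \<unlhd> w" "v \<unlhd> w" "len w \<le> len u + len v"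
    "\<forall>t'\<in>traces. u \<unlhd> t' \<longrightarrow> v \<unlhd> t' \<longrightarrow> w \<unlhd> t'"
proof -
  obtain u' v' t' where w: "u' \<in> lists S" "u = cls u'" "v' \<in> lists S" "v = cls v'"
    "t' \<in> lists S" "t = cls t'" using assms(1-3) by (elim tracesE)
  have "word_le I u' t'" "word_le I v' t'" using assms w by (simp_all add: cls_le_iff)
  from word_lub[OF this] obtain x where x: "word_le I u' x" "word_le I v' x"
    "length x \<le> length u' + length v'"
    "\<And>t'. word_le I u' t' \<Longrightarrow> word_le I v' t' \<Longrightarrow> word_le I x t'" by blast
  have "word_le I x t'" using x(4) \<open>word_le I u' t'\<close> \<open>word_le I v' t'\<close> .
  then have xS: "x \<in> lists S" using word_le_set w(5) by (fastforce simp: in_lists_conv_set)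
  show ?thesis
  proof (rule that[of "cls x"])
    show "\<forall>t'\<in>traces. u \<unlhd> t' \<longrightarrow> v \<unlhd> t' \<longrightarrow> cls x \<unlhd> t'"
      using xS w x(4) by (auto simp: cls_le_iff elim!: tracesE)
  qed (use x xS w in \<open>simp_all add: cls_le_iff\<close>)
qed

lemma finite_traces_len: "finite {u \<in> traces. len u = n}"
proof -
  have "{u \<in> traces. len u = n} \<subseteq> cls ` {w. set w \<subseteq> S \<and> length w = n}"
    by (auto elim!: tracesE simp: lists_eq_set)
  then show ?thesis by (rule finite_surj[OF finite_lists_length_eq[OF finite_S]])
qed

lemma countable_traces: "countable traces"
  unfolding traces_eq using finite_S by (intro countable_image countable_lists countable_finite)

lemma traces_of_len_add:
  assumes "u \<in> traces" "len u = m + n"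
  obtains v w where "v \<in> traces" "w \<in> traces" "len v = m" "len w = n" "u = v \<star> w"
proof -
  obtain x where x: "x \<in> lists S" "u = cls x" using assms(1) by (elim tracesE)
  have l: "take m x \<in> lists S" "drop m x \<in> lists S"
    using x(1) by (auto simp: in_lists_conv_set dest: in_set_takeD in_set_dropD)
  show ?thesis
    using l x assms(2) by (intro that[of "cls (take m x)" "cls (drop m x)"]) simp_all
qed

section \<open>Moebius inversion over cliques and synchronizing traces\<close>

lemma cliques_eq: "cliques S I = cls ` {w \<in> lists S. clique_word w}"
  by (auto simp: cliques_def clique_word_def)

lemma cliques_subset: "cliques S I \<subseteq> traces"
  by (auto simp: cliques_eq)

lemma finite_cliques: "finite (cliques S I)"
proof -
  have "{w \<in> lists S. clique_word w} \<subseteq> {w. set w \<subseteq> S \<and> length w \<le> card S}"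
  proof
    fix w assume "w \<in> {w \<in> lists S. clique_word w}"
    then have "set w \<subseteq> S" "distinct w" by (auto simp: lists_eq_set dest: clique_word_distinct)
    then show "w \<in> {w. set w \<subseteq> S \<and> length w \<le> card S}"
      using card_mono[OF finite_S, of "set w"] by (simp add: distinct_card)
  qed
  then show ?thesis
    unfolding cliques_eq using finite_lists_length_le[OF finite_S] finite_subset by blast
qed

text \<open>The letters dividing \<open>t\<close> are pairwise independent, and a clique divides
  \<open>t\<close> exactly when its letters do. The cliques below \<open>t\<close> thus correspond
  to the subsets of \<open>A\<close>, and the alternating sum vanishes unless \<open>A\<close> is
  empty, that is, unless \<open>t\<close> is the unit.\<close>

lemma sum_cliques_le:
  assumes t: "t \<in> traces"
  shows "(\<Sum>c\<in>{c \<in> cliques S I. c \<unlhd> t}. (- 1) ^ len c) =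
    (if t = unit_trace then 1 else 0 :: 'c :: comm_ring_1)"
proof -
  obtain w where w: "w \<in> lists S" "t = cls w" using t by (elim tracesE)
  define A where "A = {a \<in> S. word_le I [a] w}"
  have finA: "finite A" using finite_S by (simp add: A_def)
  \<comment> \<open>An arbitrary enumeration of \<open>B\<close>; all enumerations of a set of
    pairwise independent letters spell the same trace.\<close>
  define lst where "lst B = (SOME l. set l = B \<and> distinct l)" for B :: "'a set"
  have lst: "set (lst B) = B \<and> distinct (lst B)" if "B \<subseteq> A" for B
    unfolding lst_def using finite_distinct_list[of B] finite_subset[OF that finA]
    by (rule_tac someI_ex) blast
  have lst_S: "lst B \<in> lists S" if "B \<subseteq> A" for B
    using lst[OF that] that by (auto simp: A_def in_lists_conv_set)
  have clq: "clique_word (lst B)" if "B \<subseteq> A" for B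
    using lst[OF that] that by (auto simp: clique_word_iff A_def intro: letters_le_indep[of _ w])
  have "bij_betw (\<lambda>B. cls (lst B)) (Pow A) {c \<in> cliques S I. c \<unlhd> t}"
    unfolding bij_betw_def
  proof (intro conjI equalityI subsetI)
    show "inj_on (\<lambda>B. cls (lst B)) (Pow A)"
    proof (rule inj_onI)
      fix B C assume "B \<in> Pow A" "C \<in> Pow A" "cls (lst B) = cls (lst C)"
      then show "B = C"
        using lst_S lst clq by (metis PowD cls_eq_iff trace_eq_set)
    qed
  next
    fix c assume "c \<in> (\<lambda>B. cls (lst B)) ` Pow A"
    then obtain B where B: "B \<subseteq> A" "c = cls (lst B)" by auto
    have "word_le I (lst B) w"
      using clique_word_le_iff[OF clq[OF B(1)]] lst[OF B(1)] B(1) by (auto simp: A_def)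
    then show "c \<in> {c \<in> cliques S I. c \<unlhd> t}"
      using B clq lst_S w by (auto simp: cliques_eq cls_le_iff)
  next
    fix c assume "c \<in> {c \<in> cliques S I. c \<unlhd> t}"
    then obtain v where v: "v \<in> lists S" "clique_word v" "c = cls v" "c \<unlhd> t"
      by (auto simp: cliques_eq)
    then have "word_le I v w" using w by (simp add: cls_le_iff)
    then have sub: "set v \<subseteq> A" using v clique_word_le_iff[OF v(2)] by (auto simp: A_def in_lists_conv_set)
    then have "trace_eq I v (lst (set v))"
      using clique_word_trace_eq_iff v(2) clq lst by blast
    then have "c = cls (lst (set v))" using v(1,3) lst_S[OF sub] by (simp add: cls_eq_iff)
    then show "c \<in> (\<lambda>B. cls (lst B)) ` Pow A" using sub by blast
  qed
  then have "(\<Sum>c\<in>{c \<in> cliques S I. c \<unlhd> t}. (- 1) ^ len c) =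
      (\<Sum>B\<in>Pow A. (- 1) ^ len (cls (lst B)) :: 'c)"
    by (rule sum.reindex_bij_betw[symmetric])
  also have "\<dots> = (\<Sum>B\<in>Pow A. (- 1) ^ card B)"
  proof (rule sum.cong[OF HOL.refl])
    fix B assume "B \<in> Pow A"
    then have "length (lst B) = card B" "lst B \<in> lists S"
      using lst[of B] lst_S[of B] distinct_card by fastforce+
    then show "(- 1) ^ len (cls (lst B)) = ((- 1) ^ card B :: 'c)" by simp
  qed
  also have "\<dots> = (if A = {} then 1 else 0)" by (rule sum_alternating_Pow[OF finA])
  also have "A = {} \<longleftrightarrow> w = []"
  proof (cases w)
    case Nil
    then show ?thesis by (auto simp: A_def dest: word_le_length)
  next
    case (Cons a v)
    then have "a \<in> A" using w word_le_append[of I "[a]" v] by (simp add: A_def)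
    then show ?thesis using Cons by auto
  qed
  also have "w = [] \<longleftrightarrow> t = unit_trace"
    using len_eq_0_iff[OF t] w by simp
  finally show ?thesis .
qed

text \<open>The trace \<open>w\<close> is spelled by a walk through all letters in the dependence
  graph; \<open>chain_suffix_inj\<close> then recovers the part before \<open>w\<close> from any
  common multiple.\<close>

lemma exists_synchronizing_trace:
  assumes "irreducible_pair S I"
  obtains w where "w \<in> traces"
    "\<forall>u\<in>traces. \<forall>v\<in>traces. \<forall>t\<in>traces. len u = len v \<longrightarrow>
      u \<star> w \<unlhd> t \<longrightarrow> v \<star> w \<unlhd> t \<longrightarrow> u = v"
proof -
  obtain w where w: "w \<noteq> []" "last w \<in> S" "S \<subseteq> set w"
    "successively (\<lambda>x y. (x, y) \<in> S \<times> S - I) w"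
    using exists_covering_walk[OF finite_S subset_refl S_nonempty, of "S \<times> S - I"] assms
    by (auto simp: irreducible_pair_def)
  \<comment> \<open>Every letter but the last starts a pair in \<open>S \<times> S\<close>; the last
    one is covered by the assumption on \<open>last v\<close>.\<close>
  have "successively (\<lambda>x y. (x, y) \<in> S \<times> S - I) v \<Longrightarrow> v \<noteq> [] \<Longrightarrow> last v \<in> S \<Longrightarrow> v \<in> lists S"
    for v by (induction v rule: induct_list012) auto
  then have wS: "w \<in> lists S" using w by blast
  have chain: "successively (\<lambda>x y. (x, y) \<notin> I) w"
    using w(4) by (rule successively_mono) auto
  show ?thesis
  proof (rule that[of "cls w"]; (intro ballI impI)?)
    fix u v t assume uvt: "u \<in> traces" "v \<in> traces" "t \<in> traces" "len u = len v"
      "u \<star> cls w \<unlhd> t" "v \<star> cls w \<unlhd> t"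
    obtain u' v' t' where l: "u' \<in> lists S" "u = cls u'" "v' \<in> lists S" "v = cls v'"
      "t' \<in> lists S" "t = cls t'" using uvt(1-3) by (elim tracesE)
    have "word_le I (u' @ w) t'" "word_le I (v' @ w) t'"
      using uvt l wS by (simp_all add: cls_le_iff)
    then have "trace_eq I u' v'"
      using chain_suffix_inj[OF chain w(1), of u' v' t'] uvt(4) l w(3) by (auto simp: in_lists_conv_set)
    then show "u = v" using l by (simp add: cls_eq_iff)
  qed (use wS in simp)
qed

end

section \<open>The growth series\<close>

text \<open>Cutting the indices into blocks of length \<open>N\<close>, the \<open>k\<close>-th
  block sums to at most \<open>b N ^ k\<close> times the first, so a geometric series bounds all
  partial sums.\<close>

lemma summable_submultiplicative:
  fixes b :: "nat \<Rightarrow> real"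
  assumes nonneg: "\<And>n. 0 \<le> b n" and sub: "\<And>m n. b (m + n) \<le> b m * b n"
    and N: "b N < 1" "N > 0"
  shows "summable b"
proof (rule summableI_nonneg_bounded)
  have b: "b (k * N + r) \<le> b N ^ k * b r" for k r
  proof (induction k)
    case (Suc k)
    have "b (Suc k * N + r) \<le> b N * b (k * N + r)"
      using sub[of N "k * N + r"] by (simp add: add.assoc)
    also have "\<dots> \<le> b N * (b N ^ k * b r)" using Suc nonneg by (intro mult_left_mono) auto
    finally show ?case by (simp add: mult.assoc)
  qed simp
  define B where "B = (\<Sum>r<N. b r)"
  have B: "0 \<le> B" by (simp add: B_def nonneg sum_nonneg)
  fix n
  \<comment> \<open>Enlarging the range to \<open>n * N\<close> terms leaves exactly
    \<open>n\<close> full blocks.\<close>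
  have "(\<Sum>i<n. b i) \<le> (\<Sum>i<n * N. b i)" using N nonneg by (intro sum_mono2) auto
  also have "\<dots> = (\<Sum>k<n. \<Sum>i = k * N..<k * N + N. b i)" by (simp add: sum.nat_group)
  also have "\<dots> \<le> (\<Sum>k<n. b N ^ k * B)"
  proof (rule sum_mono)
    fix k
    have "(\<Sum>i = k * N..<k * N + N. b i) = (\<Sum>r<N. b (k * N + r))"
      using sum.shift_bounds_nat_ivl[of b 0 "k * N" N] by (simp add: add.commute atLeast0LessThan)
    also have "\<dots> \<le> (\<Sum>r<N. b N ^ k * b r)" by (intro sum_mono b)
    finally show "(\<Sum>i = k * N..<k * N + N. b i) \<le> b N ^ k * B"
      by (simp add: B_def sum_distrib_left)
  qed
  also have "\<dots> = (\<Sum>k<n. b N ^ k) * B" by (simp add: sum_distrib_right)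
  also have "\<dots> \<le> (\<Sum>k. b N ^ k) * B"
    using N nonneg B by (intro mult_right_mono sum_le_suminf summable_geometric) auto
  finally show "(\<Sum>i<n. b i) \<le> (\<Sum>k. b N ^ k) * B" .
qed (rule nonneg)

context trace_pair
begin

definition tcount :: "nat \<Rightarrow> nat" where
  "tcount n = card {u \<in> traces. len u = n}"

text \<open>Generic in the field: the real instance normalizes weights, the complex one locates
  roots.\<close>

definition mob :: "'c :: {real_normed_field, banach} \<Rightarrow> 'c" where
  "mob z = (\<Sum>c\<in>cliques S I. (- 1) ^ len c * z ^ len c)"

lemma poly_moebius_poly: "poly (moebius_poly S I) z = mob z"
  by (simp add: moebius_poly_def mob_def poly_sum poly_monom)

lemma tcount_0: "tcount 0 = 1"
proof -
  have "{u \<in> traces. len u = 0} = {unit_trace}" using len_eq_0_iff by auto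
  then show ?thesis by (simp add: tcount_def)
qed

lemma tcount_ge_1: "1 \<le> tcount n"
proof -
  obtain a where "a \<in> S" using S_nonempty by blast
  then have "replicate n a \<in> lists S" by (auto simp: in_lists_conv_set)
  then have "cls (replicate n a) \<in> {u \<in> traces. len u = n}" by simp
  then have "tcount n \<noteq> 0"
    unfolding tcount_def using finite_traces_len card_0_eq by blast
  then show ?thesis by simp
qed

lemma tcount_add: "tcount (m + n) \<le> tcount m * tcount n"
proof -
  let ?T = "\<lambda>n. {u \<in> traces. len u = n}"
  have "?T (m + n) \<subseteq> (\<lambda>(u, v). u \<star> v) ` (?T m \<times> ?T n)"
    by (fastforce elim: traces_of_len_add)
  then have "card (?T (m + n)) \<le> card (?T m \<times> ?T n)"
    by (intro surj_card_le finite_cartesian_product finite_traces_len) auto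
  then show ?thesis by (simp add: tcount_def card_cartesian_product)
qed

text \<open>Left multiplication by \<open>c\<close> is injective, so multiples of \<open>c\<close>
  are counted by their cofactors.\<close>

lemma card_multiples:
  assumes c: "c \<in> traces"
  shows "card {u \<in> traces. len u = n \<and> c \<unlhd> u} = (if len c \<le> n then tcount (n - len c) else 0)"
proof (cases "len c \<le> n")
  case True
  have "{u \<in> traces. len u = n \<and> c \<unlhd> u} = (\<lambda>v. c \<star> v) ` {v \<in> traces. len v = n - len c}"
    using c True by (auto simp: factor_def image_iff)
  moreover have "inj_on (\<lambda>v. c \<star> v) {v \<in> traces. len v = n - len c}"
    using c by (auto simp: inj_on_def mul_left_cancel)
  ultimately show ?thesis using True by (simp add: tcount_def card_image)
next
  case False
  then have "{u \<in> traces. len u = n \<and> c \<unlhd> u} = {}" using le_len[OF _ c] by auto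
  with False show ?thesis by (simp only: card.empty if_False)
qed

text \<open>Signed double counting of the pairs \<open>c \<unlhd> u\<close> with
  \<open>len u = n\<close>: summing over \<open>u\<close> first gives the left side, summing over
  \<open>c\<close> first leaves only the unit. This is the \<open>n\<close>-th coefficient of the
  growth series times the Moebius polynomial.\<close>

lemma tcount_recurrence:
  "(\<Sum>c\<in>cliques S I. (- 1) ^ len c * (if len c \<le> n then of_nat (tcount (n - len c)) else 0)) =
    (if n = 0 then 1 else 0 :: 'c :: comm_ring_1)"
proof -
  let ?T = "{u \<in> traces. len u = n}"
  have fin: "finite ?T" by (rule finite_traces_len)
  have "(\<Sum>c\<in>cliques S I. (- 1) ^ len c * (if len c \<le> n then of_nat (tcount (n - len c)) else 0)) =
      (\<Sum>c\<in>cliques S I. \<Sum>u\<in>?T. if c \<unlhd> u then (- 1) ^ len c else 0 :: 'c)"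
  proof (rule sum.cong[OF HOL.refl])
    fix c assume "c \<in> cliques S I"
    then have c: "c \<in> traces" using cliques_subset by blast
    have "?T \<inter> {u. c \<unlhd> u} = {u \<in> traces. len u = n \<and> c \<unlhd> u}" by auto
    then have "(\<Sum>u\<in>?T. if c \<unlhd> u then (- 1) ^ len c else 0 :: 'c) =
        (\<Sum>u\<in>{u \<in> traces. len u = n \<and> c \<unlhd> u}. (- 1) ^ len c)"
      using fin by (simp add: sum.If_cases)
    also have "\<dots> = (- 1) ^ len c * of_nat (card {u \<in> traces. len u = n \<and> c \<unlhd> u})"
      by (simp add: mult.commute)
    finally show "(- 1) ^ len c * (if len c \<le> n then of_nat (tcount (n - len c)) else 0) =
        (\<Sum>u\<in>?T. if c \<unlhd> u then (- 1) ^ len c else 0 :: 'c)"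
      by (simp add: card_multiples[OF c])
  qed
  also have "\<dots> = (\<Sum>u\<in>?T. \<Sum>c\<in>cliques S I. if c \<unlhd> u then (- 1) ^ len c else 0)"
    by (rule sum.swap)
  also have "\<dots> = (\<Sum>u\<in>?T. if u = unit_trace then 1 else 0)"
  proof (rule sum.cong[OF HOL.refl])
    fix u assume "u \<in> ?T"
    moreover have "cliques S I \<inter> {c. c \<unlhd> u} = {c \<in> cliques S I. c \<unlhd> u}" by auto
    ultimately show "(\<Sum>c\<in>cliques S I. if c \<unlhd> u then (- 1) ^ len c else 0) =
        (if u = unit_trace then 1 else 0 :: 'c)"
      using finite_cliques sum_cliques_le[of u] by (simp add: sum.If_cases)
  qed
  also have "\<dots> = (if unit_trace \<in> ?T then 1 else 0)" using fin by simp
  also have "unit_trace \<in> ?T \<longleftrightarrow> n = 0" by auto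
  finally show ?thesis .
qed

text \<open>Shifting coefficients by \<open>k\<close> multiplies the series by \<open>z ^ k\<close>.
  This serves both the product with the Moebius polynomial and the mass of the multiples of a
  trace.\<close>

lemma growth_shift_sums:
  fixes z :: "'c :: {real_normed_field, banach}"
  assumes "summable (\<lambda>n. real (tcount n) * norm z ^ n)"
  shows "(\<lambda>n. (if k \<le> n then of_nat (tcount (n - k)) else 0) * z ^ n) sums
    (z ^ k * (\<Sum>n. of_nat (tcount n) * z ^ n))" (is "?f sums (_ * ?G)")
proof -
  have "summable (\<lambda>n. norm (of_nat (tcount n) * z ^ n))"
    using assms by (simp add: norm_mult norm_power)
  then have G: "(\<lambda>n. of_nat (tcount n) * z ^ n) sums ?G"
    by (rule summable_sums[OF summable_norm_cancel])
  have "(\<lambda>n. ?f (n + k)) = (\<lambda>n. z ^ k * (of_nat (tcount n) * z ^ n))"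
    by (simp add: power_add mult_ac)
  then have "(\<lambda>n. ?f (n + k)) sums (z ^ k * ?G)"
    using sums_mult[OF G, of "z ^ k"] by simp
  then show ?thesis by (subst (asm) sums_iff_shift) simp
qed

lemma growth_mult_mob:
  fixes z :: "'c :: {real_normed_field, banach}"
  assumes "summable (\<lambda>n. real (tcount n) * norm z ^ n)"
  shows "(\<Sum>n. of_nat (tcount n) * z ^ n) * mob z = 1"
proof -
  let ?G = "\<Sum>n. of_nat (tcount n) * z ^ n"
  let ?f = "\<lambda>c n. (if len c \<le> n then of_nat (tcount (n - len c)) else 0) * z ^ n"
  have "?f c sums (z ^ len c * ?G)" for c using assms by (rule growth_shift_sums)
  then have "(\<lambda>n. \<Sum>c\<in>cliques S I. (- 1) ^ len c * ?f c n) sums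
      (\<Sum>c\<in>cliques S I. (- 1) ^ len c * (z ^ len c * ?G))"
    by (intro sums_sum sums_mult)
  moreover have "(\<Sum>c\<in>cliques S I. (- 1) ^ len c * ?f c n) = (if n = 0 then 1 else 0)" for n
  proof -
    have "(\<Sum>c\<in>cliques S I. (- 1) ^ len c * ?f c n) =
        (\<Sum>c\<in>cliques S I. (- 1) ^ len c *
          (if len c \<le> n then of_nat (tcount (n - len c)) else 0)) * z ^ n"
      unfolding sum_distrib_right by (intro sum.cong) auto
    then show ?thesis unfolding tcount_recurrence by auto
  qed
  moreover have "(\<Sum>c\<in>cliques S I. (- 1) ^ len c * (z ^ len c * ?G)) = ?G * mob z"
    by (simp add: mob_def sum_distrib_left mult_ac)
  ultimately have "(\<lambda>n. if n = 0 then 1 else 0) sums (?G * mob z)" by simp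
  moreover have "(\<lambda>n. if n = 0 then 1 else 0) sums (1 :: 'c)"
    using sums_single[of 0 "\<lambda>_. 1 :: 'c"] by simp
  ultimately show ?thesis using sums_unique2 by blast
qed

lemma tendsto_mob: "(mob \<longlongrightarrow> mob x) (at x within A)"
  unfolding mob_def by (intro tendsto_intros)

text \<open>The radius of convergence \<open>R\<close> is itself a root, and
  \<open>growth_mult_mob\<close> excludes roots of smaller modulus.\<close>

lemma smallest_root:
  assumes p0: "unique_smallest_root (moebius_poly S I) p0"
  obtains R where "p0 = complex_of_real R" "0 < R" "R \<le> 1" "mob R = 0"
    "\<forall>x. 0 \<le> x \<and> x < R \<longrightarrow> summable (\<lambda>n. real (tcount n) * x ^ n)"
    "\<forall>n. 1 \<le> real (tcount n) * R ^ n"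
proof -
  define X where "X = {x. 0 \<le> x \<and> summable (\<lambda>n. real (tcount n) * x ^ n)}"
  have X_le: "x \<le> 1" if x: "x \<in> X" for x
  proof (rule ccontr)
    assume "\<not> x \<le> 1"
    then have "1 \<le> real (tcount n) * x ^ n" for n
      using tcount_ge_1[of n] one_le_power[of x n] mult_mono[of 1 "real (tcount n)" 1 "x ^ n"]
      by auto
    moreover have "(\<lambda>n. real (tcount n) * x ^ n) \<longlonglongrightarrow> 0"
      using x by (auto simp: X_def intro: summable_LIMSEQ_zero)
    ultimately have "(1 :: real) \<le> 0" by (intro LIMSEQ_le_const) auto
    then show False by simp
  qed
  then have bdd: "bdd_above X" by (rule bdd_aboveI)
  have sub: "real (tcount (m + n)) * x ^ (m + n) \<le>
      (real (tcount m) * x ^ m) * (real (tcount n) * x ^ n)" if "0 \<le> x" for x m n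
  proof -
    have "real (tcount (m + n)) \<le> real (tcount m) * real (tcount n)"
      using tcount_add[of m n] by (metis of_nat_le_iff of_nat_mult)
    then have "real (tcount (m + n)) * (x ^ m * x ^ n) \<le>
        (real (tcount m) * real (tcount n)) * (x ^ m * x ^ n)"
      using that by (intro mult_right_mono) auto
    then show ?thesis by (simp add: power_add mult_ac)
  qed
  \<comment> \<open>By submultiplicativity, a single term below 1 already forces
    convergence.\<close>
  have memX: "x \<in> X" if "0 \<le> x" "real (tcount N) * x ^ N < 1" for x N
  proof -
    have "N > 0" using that tcount_0 by (cases N) auto
    then have "summable (\<lambda>n. real (tcount n) * x ^ n)"
      using that sub by (intro summable_submultiplicative[of _ N]) auto
    then show ?thesis using that by (simp add: X_def)
  qed
  \<comment> \<open>With this choice the term of index 1 equals 1/2, so \<open>y\<close> witnesses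
    that \<open>R\<close> is positive.\<close>
  define y where "y = 1 / (2 * real (tcount 1))"
  have t1: "real (tcount 1) \<ge> 1" using tcount_ge_1[of 1] by simp
  then have y: "0 < y" "real (tcount 1) * y ^ 1 < 1" by (auto simp: y_def)
  then have "y \<in> X" using memX[of y 1] by simp
  define R where "R = Sup X"
  have R: "0 < R" using cSup_upper[OF \<open>y \<in> X\<close> bdd] y by (simp add: R_def)
  have R1: "R \<le> 1" unfolding R_def using \<open>y \<in> X\<close> X_le by (intro cSup_least) auto
  have summ: "summable (\<lambda>n. real (tcount n) * x ^ n)" if x: "0 \<le> x" "x < R" for x
  proof -
    obtain z where z: "z \<in> X" "x < z"
      using x \<open>y \<in> X\<close> less_cSup_iff[OF _ bdd] by (auto simp: R_def)
    show ?thesis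
    proof (rule summable_comparison_test')
      show "summable (\<lambda>n. real (tcount n) * z ^ n)" using z by (simp add: X_def)
      show "norm (real (tcount n) * x ^ n) \<le> real (tcount n) * z ^ n" if "n \<ge> 0" for n
        using z x by (auto intro!: mult_left_mono power_mono)
    qed
  qed
  \<comment> \<open>A term below 1 at \<open>R\<close> would stay below 1 slightly to the right,
    where \<open>memX\<close> would give convergence beyond the supremum.\<close>
  have ge1: "1 \<le> real (tcount n) * R ^ n" for n
  proof (rule ccontr)
    assume "\<not> 1 \<le> real (tcount n) * R ^ n"
    then have lt: "real (tcount n) * R ^ n < 1" by simp
    have "((\<lambda>x. real (tcount n) * x ^ n) \<longlongrightarrow> real (tcount n) * R ^ n) (at_right R)"
      by (intro tendsto_intros)
    from order_tendstoD(2)[OF this lt]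
    have "eventually (\<lambda>x. real (tcount n) * x ^ n < 1 \<and> R < x) (at_right R)"
      using eventually_at_right_less[of R] by (rule eventually_conj)
    then obtain x where x: "real (tcount n) * x ^ n < 1" "R < x"
      using eventually_happens'[OF trivial_limit_at_right_real] by blast
    then have "x \<in> X" using memX R by auto
    then show False using cSup_upper[OF _ bdd, of x] x by (simp add: R_def)
  qed
  \<comment> \<open>If \<open>mob R\<close> were nonzero, the growth series would stay bounded as
    \<open>x\<close> increases to \<open>R\<close>; but by \<open>ge1\<close> its first
    \<open>K\<close> terms at \<open>R\<close> already sum to at least \<open>K\<close>.\<close>
  have mobR: "mob R = 0"
  proof (rule ccontr)
    assume "mob R \<noteq> 0"
    then obtain K where K: "1 < real K * \<bar>mob R\<bar>"
      using reals_Archimedean3[of "\<bar>mob R\<bar>"] by auto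
    have "(\<Sum>n<K. real (tcount n) * x ^ n) * \<bar>mob x\<bar> \<le> 1" if x: "0 \<le> x" "x < R" for x
    proof -
      have "(\<Sum>n<K. real (tcount n) * x ^ n) \<le> (\<Sum>n. real (tcount n) * x ^ n)"
        using x by (intro sum_le_suminf summ) auto
      then have "(\<Sum>n<K. real (tcount n) * x ^ n) * \<bar>mob x\<bar> \<le>
          (\<Sum>n. real (tcount n) * x ^ n) * \<bar>mob x\<bar>" by (intro mult_right_mono) auto
      also have "\<dots> = \<bar>(\<Sum>n. real (tcount n) * x ^ n) * mob x\<bar>"
        using x by (simp add: abs_mult suminf_nonneg summ)
      also have "\<dots> = 1" using growth_mult_mob[of x] x summ by simp
      finally show ?thesis .
    qed
    moreover have "eventually (\<lambda>x. 0 \<le> x \<and> x < R) (at_left R)"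
      using eventually_at_left_real[OF R] by (auto elim: eventually_mono)
    ultimately have "eventually (\<lambda>x. (\<Sum>n<K. real (tcount n) * x ^ n) * \<bar>mob x\<bar> \<le> 1) (at_left R)"
      by (auto elim: eventually_mono)
    moreover have "((\<lambda>x. (\<Sum>n<K. real (tcount n) * x ^ n) * \<bar>mob x\<bar>) \<longlongrightarrow>
        (\<Sum>n<K. real (tcount n) * R ^ n) * \<bar>mob R\<bar>) (at_left R)"
      by (intro tendsto_intros tendsto_mob)
    ultimately have "(\<Sum>n<K. real (tcount n) * R ^ n) * \<bar>mob R\<bar> \<le> 1"
      by (intro tendsto_upperbound[OF _ _ trivial_limit_at_left_real])
    moreover have "real K \<le> (\<Sum>n<K. real (tcount n) * R ^ n)"
      using sum_mono[of "{..<K}" "\<lambda>_. 1" "\<lambda>n. real (tcount n) * R ^ n"] ge1 by simp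
    then have "real K * \<bar>mob R\<bar> \<le> (\<Sum>n<K. real (tcount n) * R ^ n) * \<bar>mob R\<bar>"
      by (intro mult_right_mono) auto
    ultimately show False using K by linarith
  qed
  have "mob (complex_of_real R) = of_real (mob R)" by (simp add: mob_def)
  then have root: "poly (moebius_poly S I) (complex_of_real R) = 0"
    by (simp add: poly_moebius_poly mobR)
  \<comment> \<open>If \<open>p0\<close> differed from the root \<open>R\<close>, its modulus would
    be smaller, and inside the disc of convergence \<open>mob\<close> has no zero.\<close>
  have "p0 = complex_of_real R"
  proof (rule ccontr)
    assume "p0 \<noteq> complex_of_real R"
    then have "cmod p0 < R" "mob p0 = 0"
      using p0 root R by (auto simp: unique_smallest_root_def poly_moebius_poly)
    then show False using growth_mult_mob[of p0] summ[of "cmod p0"] by simp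
  qed
  then show thesis using that R R1 mobR summ ge1 by blast
qed

end

section \<open>The boundary\<close>

context trace_pair
begin

section \<open>Boundary points as sequences of unbounded length\<close>

lemma trace_seqs_closed: "s \<in> trace_seqs S I \<Longrightarrow> s k \<in> traces"
  by (simp add: trace_seqs_def)

lemma trace_seqs_mono: "s \<in> trace_seqs S I \<Longrightarrow> j \<le> k \<Longrightarrow> s j \<unlhd> s k"
  by (simp add: trace_seqs_def)

lemma const_in_trace_seqs [simp]: "u \<in> traces \<Longrightarrow> (\<lambda>_. u) \<in> trace_seqs S I"
  by (simp add: trace_seqs_def)

lemma seq_rel_refl: "s \<in> trace_seqs S I \<Longrightarrow> (s, s) \<in> seq_rel S I"
  by (auto simp: seq_rel_def seq_le_def trace_seqs_closed intro!: exI le_refl)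

text \<open>Lets the order be tested on one fixed representative instead of on some pair of
  representatives.\<close>

lemma gen_le_embed_iff:
  assumes s: "s \<in> trace_seqs S I" and u: "u \<in> traces"
  shows "gen_le S I (embed S I u) (seq_rel S I `` {s}) \<longleftrightarrow> (\<exists>k. u \<unlhd> s k)"
proof
  assume "gen_le S I (embed S I u) (seq_rel S I `` {s})"
  then obtain s' t where *: "(\<lambda>_. u, s') \<in> seq_rel S I" "(s, t) \<in> seq_rel S I" "seq_le S I s' t"
    by (auto simp: gen_le_def embed_def)
  obtain j where j: "u \<unlhd> s' j" using *(1) by (auto simp: seq_rel_def seq_le_def)
  obtain k where k: "s' j \<unlhd> t k" using *(3) unfolding seq_le_def by blast
  obtain l where l: "t k \<unlhd> s l" using *(2) unfolding seq_rel_def seq_le_def by blast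
  show "\<exists>k. u \<unlhd> s k" using le_trans[OF le_trans[OF j k u] l u] by blast
next
  assume "\<exists>k. u \<unlhd> s k"
  then have "seq_le S I (\<lambda>_. u) s" by (simp add: seq_le_def)
  moreover have "(\<lambda>_. u) \<in> embed S I u" using seq_rel_refl u by (simp add: embed_def)
  moreover have "s \<in> seq_rel S I `` {s}" using seq_rel_refl s by simp
  ultimately show "gen_le S I (embed S I u) (seq_rel S I `` {s})" by (auto simp: gen_le_def)
qed

lemma trans_seq_rel: "trans (seq_rel S I)"
proof -
  have "seq_le S I s r" if "seq_le S I s t" "seq_le S I t r" "s \<in> trace_seqs S I" for s t r
    unfolding seq_le_def
  proof
    fix k
    have "\<exists>j. s k \<unlhd> t j" using that(1) unfolding seq_le_def ..
    then obtain j where j: "s k \<unlhd> t j" ..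
    have "\<exists>l. t j \<unlhd> r l" using that(2) unfolding seq_le_def ..
    then obtain l where l: "t j \<unlhd> r l" ..
    show "\<exists>k'. s k \<unlhd> r k'" using le_trans[OF j l] that(3) trace_seqs_closed by blast
  qed
  then show ?thesis unfolding trans_def seq_rel_def by blast
qed

lemma equiv_seq_rel: "equiv (trace_seqs S I) (seq_rel S I)"
  by (intro equivI trans_seq_rel) (auto simp: refl_on_def seq_rel_refl sym_def, auto simp: seq_rel_def)

text \<open>A sequence of bounded length is constant from an index of maximal length on, hence
  equivalent to a constant sequence and not a boundary point.\<close>

lemma boundaryE:
  assumes "\<xi> \<in> boundary S I"
  obtains s where "s \<in> trace_seqs S I" "\<forall>u\<in>traces. \<xi> \<in> up S I u \<longleftrightarrow> (\<exists>k. u \<unlhd> s k)"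
    "\<forall>n. \<exists>k. n \<le> len (s k)"
proof -
  obtain s where s: "s \<in> trace_seqs S I" "\<xi> = seq_rel S I `` {s}"
    using assms by (auto simp: boundary_def gen_traces_def quotient_def)
  have "\<exists>k. n \<le> len (s k)" for n
  proof (rule ccontr)
    assume "\<not> (\<exists>k. n \<le> len (s k))"
    then have "\<forall>k. len (s k) < n" by (auto simp: not_le)
    then obtain m where m: "\<And>k. len (s k) \<le> len (s m)"
      using ex_has_greatest_nat[of "\<lambda>_. True" 0 "\<lambda>k. len (s k)" n] by auto
    have "s k \<unlhd> s m" for k
    proof (cases "k \<le> m")
      case False
      then have "s m \<unlhd> s k" using trace_seqs_mono s by simp
      then have "s m = s k" using le_len_eq m trace_seqs_closed s by blast
      then show ?thesis using trace_seqs_closed s by simp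
    qed (use trace_seqs_mono s in simp)
    then have "(\<lambda>_. s m, s) \<in> seq_rel S I"
      using s trace_seqs_closed by (auto simp: seq_rel_def seq_le_def intro!: exI[of _ m])
    then have "\<xi> = embed S I (s m)"
      using equiv_class_eq[OF equiv_seq_rel] s(2) unfolding embed_def by metis
    then show False using assms s(1) trace_seqs_closed by (auto simp: boundary_def)
  qed
  moreover have "\<xi> \<in> up S I u \<longleftrightarrow> (\<exists>k. u \<unlhd> s k)" if "u \<in> traces" for u
    using gen_le_embed_iff[OF s(1) that] assms s(2) by (simp add: up_def)
  ultimately show ?thesis using that s(1) by blast
qed

text \<open>A countable directed set has a cofinal increasing sequence, which represents the desired
  point. Unbounded lengths keep it from being equivalent to a constant.\<close>

lemma boundary_of_ideal:
  assumes sub: "J \<subseteq> traces"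
    and down: "\<And>u v. u \<in> traces \<Longrightarrow> v \<in> J \<Longrightarrow> u \<unlhd> v \<Longrightarrow> u \<in> J"
    and dir: "\<And>u v. u \<in> J \<Longrightarrow> v \<in> J \<Longrightarrow> \<exists>w\<in>J. u \<unlhd> w \<and> v \<unlhd> w"
    and unbounded: "\<And>n. \<exists>u\<in>J. n \<le> len u"
  shows "\<exists>\<xi>\<in>boundary S I. \<forall>u\<in>traces. \<xi> \<in> up S I u \<longleftrightarrow> u \<in> J"
proof -
  have cJ: "countable J" using countable_subset[OF sub countable_traces] .
  have "J \<noteq> {}" using unbounded by blast
  define e where "e = from_nat_into J"
  have e: "e k \<in> J" for k using \<open>J \<noteq> {}\<close> by (simp add: e_def from_nat_into)
  define up2 where "up2 u v = (SOME w. w \<in> J \<and> u \<unlhd> w \<and> v \<unlhd> w)" for u v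
  have up2: "up2 u v \<in> J \<and> u \<unlhd> up2 u v \<and> v \<unlhd> up2 u v" if "u \<in> J" "v \<in> J" for u v
    unfolding up2_def by (rule someI_ex) (use dir[OF that] in blast)
  \<comment> \<open>Each step joins in the next element of the enumeration, which makes
    \<open>s\<close> increasing and cofinal in \<open>J\<close>.\<close>
  define s where "s = rec_nat (e 0) (\<lambda>k u. up2 u (e (Suc k)))"
  have s0: "s 0 = e 0" and sS: "s (Suc k) = up2 (s k) (e (Suc k))" for k
    by (simp_all add: s_def)
  have sJ: "s k \<in> J" for k by (induction k) (simp_all add: s0 sS e up2)
  have step: "s k \<unlhd> s (Suc k)" for k using up2 sJ e by (simp add: sS)
  have es: "e k \<unlhd> s k" for k
  proof (cases k)
    case 0
    then show ?thesis using e[of 0] sub by (auto simp: s0)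
  next
    case (Suc m)
    then show ?thesis using up2 sJ e by (simp add: sS)
  qed
  have "s j \<unlhd> s (j + d)" for j d
  proof (induction d)
    case 0
    show ?case using sJ[of j] sub by auto
  next
    case (Suc d)
    then show ?case using le_trans[OF Suc step] sJ sub by auto
  qed
  then have seq: "s \<in> trace_seqs S I"
    using sJ sub by (auto simp: trace_seqs_def le_iff_add)
  define \<xi> where "\<xi> = seq_rel S I `` {s}"
  have "\<xi> \<noteq> embed S I v" for v
  proof
    assume "\<xi> = embed S I v"
    moreover have "s \<in> \<xi>" using seq_rel_refl[OF seq] by (simp add: \<xi>_def)
    ultimately have "(\<lambda>_. v, s) \<in> seq_rel S I" by (simp add: embed_def)
    then have le: "s k \<unlhd> v" for k by (auto simp: seq_rel_def seq_le_def)
    obtain u where u: "u \<in> J" "Suc (len v) \<le> len u" using unbounded by blast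
    then obtain k where "u = e k"
      using from_nat_into_surj[OF cJ] by (metis e_def)
    then have "u \<unlhd> v" using le_trans[OF es le] u sub by blast
    then show False using le_len[of u v] u sub by auto
  qed
  moreover have "\<xi> \<in> gen_traces S I"
    using seq by (auto simp: \<xi>_def gen_traces_def intro: quotientI)
  ultimately have \<xi>: "\<xi> \<in> boundary S I" by (auto simp: boundary_def)
  moreover have "\<xi> \<in> up S I u \<longleftrightarrow> u \<in> J" if u: "u \<in> traces" for u
  proof -
    have "\<xi> \<in> up S I u \<longleftrightarrow> (\<exists>k. u \<unlhd> s k)"
      using gen_le_embed_iff[OF seq u] \<xi> by (simp add: up_def \<xi>_def)
    also have "\<dots> \<longleftrightarrow> u \<in> J"
    proof
      show "u \<in> J" if "\<exists>k. u \<unlhd> s k" using that down[OF u sJ] by blast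
      show "\<exists>k. u \<unlhd> s k" if "u \<in> J"
        using from_nat_into_surj[OF cJ that] es by (metis e_def)
    qed
    finally show ?thesis .
  qed
  ultimately show ?thesis by blast
qed

section \<open>The sets \<open>up u\<close> and inclusion-exclusion\<close>

lemma up_unit: "up S I unit_trace = boundary S I"
proof -
  have "\<xi> \<in> up S I unit_trace" if "\<xi> \<in> boundary S I" for \<xi>
    using that trace_seqs_closed by (auto elim!: boundaryE)
  then show ?thesis by (auto simp: up_def)
qed

text \<open>A point in both sets provides a common multiple of \<open>u\<close> and
  \<open>v\<close>, so a least upper bound \<open>w\<close> exists and the intersection is
  \<open>up w\<close>. The empty set accounts for traces without a common multiple.\<close>

lemma up_Int:
  assumes u: "u \<in> traces" and v: "v \<in> traces"
  shows "up S I u \<inter> up S I v \<in> insert {} (up S I ` traces)"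
proof (cases "up S I u \<inter> up S I v = {}")
  case False
  then obtain \<xi> where \<xi>: "\<xi> \<in> up S I u" "\<xi> \<in> up S I v" by blast
  then have b: "\<xi> \<in> boundary S I" by (simp add: up_def)
  have common: "\<exists>k. u \<unlhd> s k \<and> v \<unlhd> s k"
    if "s \<in> trace_seqs S I" "u \<unlhd> s i" "v \<unlhd> s j" for s i j
    using le_trans[OF that(2) trace_seqs_mono[OF that(1), of i "max i j"] u]
      le_trans[OF that(3) trace_seqs_mono[OF that(1), of j "max i j"] v] by auto
  obtain s where s: "s \<in> trace_seqs S I" "\<forall>u\<in>traces. \<xi> \<in> up S I u \<longleftrightarrow> (\<exists>k. u \<unlhd> s k)"
    "\<forall>n. \<exists>k. n \<le> len (s k)" by (rule boundaryE[OF b])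
  obtain i j where "u \<unlhd> s i" "v \<unlhd> s j" using s(2) \<xi> u v by blast
  then obtain k where k: "u \<unlhd> s k" "v \<unlhd> s k" using common[OF s(1)] by blast
  obtain w where w: "w \<in> traces" "u \<unlhd> w" "v \<unlhd> w" "len w \<le> len u + len v"
    "\<forall>t'\<in>traces. u \<unlhd> t' \<longrightarrow> v \<unlhd> t' \<longrightarrow> w \<unlhd> t'"
    by (rule trace_lub[OF u v trace_seqs_closed[OF s(1)] k])
  have "\<eta> \<in> up S I u \<inter> up S I v \<longleftrightarrow> \<eta> \<in> up S I w" if b: "\<eta> \<in> boundary S I" for \<eta>
  proof -
    obtain s where s: "s \<in> trace_seqs S I" "\<forall>u\<in>traces. \<eta> \<in> up S I u \<longleftrightarrow> (\<exists>k. u \<unlhd> s k)"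
    "\<forall>n. \<exists>k. n \<le> len (s k)" by (rule boundaryE[OF b])
    have "(\<exists>i. u \<unlhd> s i) \<and> (\<exists>j. v \<unlhd> s j) \<longleftrightarrow> (\<exists>k. w \<unlhd> s k)"
    proof
      assume "(\<exists>i. u \<unlhd> s i) \<and> (\<exists>j. v \<unlhd> s j)"
      then obtain k where "u \<unlhd> s k" "v \<unlhd> s k" using common[OF s(1)] by blast
      then show "\<exists>k. w \<unlhd> s k" using w(5) trace_seqs_closed[OF s(1), of k] by blast
    next
      assume "\<exists>k. w \<unlhd> s k"
      then obtain k where k: "w \<unlhd> s k" ..
      show "(\<exists>i. u \<unlhd> s i) \<and> (\<exists>j. v \<unlhd> s j)"
        using le_trans[OF w(2) k u] le_trans[OF w(3) k v] by blast
    qed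
    then show ?thesis using s(2) u v w(1) by simp
  qed
  then have "up S I u \<inter> up S I v = up S I w" by (auto simp: up_def)
  then show ?thesis using w by blast
qed simp

lemma up_mono: "u \<in> traces \<Longrightarrow> v \<in> traces \<Longrightarrow> u \<unlhd> v \<Longrightarrow> up S I v \<subseteq> up S I u"
proof
  fix \<xi> assume *: "u \<in> traces" "v \<in> traces" "u \<unlhd> v" "\<xi> \<in> up S I v"
  then have b: "\<xi> \<in> boundary S I" by (simp add: up_def)
  obtain s where s: "s \<in> trace_seqs S I" "\<forall>u\<in>traces. \<xi> \<in> up S I u \<longleftrightarrow> (\<exists>k. u \<unlhd> s k)"
    "\<forall>n. \<exists>k. n \<le> len (s k)" by (rule boundaryE[OF b])
  obtain k where "v \<unlhd> s k" using s(2) * by blast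
  then show "\<xi> \<in> up S I u" using le_trans[of u v "s k"] s(2) * by blast
qed

text \<open>For a point of \<open>up u\<close>, a late member of its sequence has the form
  \<open>u \<star> t\<close> with \<open>t\<close> nontrivial and contains every
  \<open>u \<star> c\<close> below the point. The sum then runs over the cliques dividing
  \<open>t\<close> and vanishes by \<open>sum_cliques_le\<close>.\<close>

lemma sum_cliques_indicator:
  assumes u: "u \<in> traces"
  shows "(\<Sum>c\<in>cliques S I. (- 1) ^ len c * indicator (up S I (u \<star> c)) \<xi>) = (0 :: real)"
proof (cases "\<xi> \<in> up S I u")
  case False
  have "indicator (up S I (u \<star> c)) \<xi> = (0 :: real)" if "c \<in> cliques S I" for c
  proof -
    have "c \<in> traces" using that cliques_subset by blast
    then have "up S I (u \<star> c) \<subseteq> up S I u" using u by (intro up_mono) auto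
    then show ?thesis using False by (auto simp: indicator_def)
  qed
  then show ?thesis by simp
next
  case True
  then have b: "\<xi> \<in> boundary S I" by (simp add: up_def)
  obtain s where s: "s \<in> trace_seqs S I" "\<forall>u\<in>traces. \<xi> \<in> up S I u \<longleftrightarrow> (\<exists>k. u \<unlhd> s k)"
    "\<forall>n. \<exists>k. n \<le> len (s k)" by (rule boundaryE[OF b])
  obtain k0 where k0: "u \<unlhd> s k0" using True s u by blast
  obtain k1 where k1: "Suc (len u) \<le> len (s k1)" using s(3) by blast
  have "\<exists>k. \<xi> \<in> up S I (u \<star> c) \<longrightarrow> u \<star> c \<unlhd> s k" if "c \<in> cliques S I" for c
    using s(2)[rule_format, of "u \<star> c"] u that cliques_subset by auto
  then obtain K where K: "\<And>c. c \<in> cliques S I \<Longrightarrow> \<xi> \<in> up S I (u \<star> c) \<Longrightarrow> u \<star> c \<unlhd> s (K c)"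
    by metis
  \<comment> \<open>Finitely many cliques allow one index \<open>m\<close> past the appearance of
    \<open>u\<close>, past length \<open>len u\<close>, and past the appearance of each relevant
    \<open>u \<star> c\<close>.\<close>
  define m where "m = Max (insert k0 (insert k1 (K ` cliques S I)))"
  have fin: "finite (insert k0 (insert k1 (K ` cliques S I)))" using finite_cliques by simp
  have m: "k0 \<le> m" "k1 \<le> m" "\<And>c. c \<in> cliques S I \<Longrightarrow> K c \<le> m"
    unfolding m_def using Max_ge[OF fin] by simp_all
  have "u \<unlhd> s m" using le_trans[OF k0 trace_seqs_mono[OF s(1) m(1)] u] .
  then obtain t where t: "t \<in> traces" "s m = u \<star> t" by (auto simp: factor_def)
  have "len (s k1) \<le> len (s m)"
    using le_len[OF trace_seqs_mono[OF s(1) m(2)]] trace_seqs_closed s(1) by blast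
  then have "t \<noteq> unit_trace" using k1 t u by auto
  have iff: "\<xi> \<in> up S I (u \<star> c) \<longleftrightarrow> c \<unlhd> t" if c: "c \<in> cliques S I" for c
  proof -
    have cM: "c \<in> traces" using c cliques_subset by blast
    have "\<xi> \<in> up S I (u \<star> c) \<longleftrightarrow> u \<star> c \<unlhd> s m"
      using K[OF c] s(2)[rule_format, of "u \<star> c"] u cM
        le_trans[OF _ trace_seqs_mono[OF s(1) m(3)[OF c]], of "u \<star> c"] by auto
    then show ?thesis using t u cM by simp
  qed
  have "(\<Sum>c\<in>cliques S I. (- 1) ^ len c * indicator (up S I (u \<star> c)) \<xi>) =
      (\<Sum>c\<in>cliques S I. if c \<unlhd> t then (- 1) ^ len c else 0 :: real)"
    using iff by (intro sum.cong) (auto simp: indicator_def)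
  also have "\<dots> = (\<Sum>c\<in>{c \<in> cliques S I. c \<unlhd> t}. (- 1) ^ len c)"
    using finite_cliques by (simp add: sum.inter_filter)
  also have "\<dots> = 0" using sum_cliques_le[OF t(1)] \<open>t \<noteq> unit_trace\<close> by simp
  finally show ?thesis .
qed

section \<open>Probability measures on the boundary\<close>

lemma up_subset: "up S I ` traces \<subseteq> Pow (boundary S I)"
  by (auto simp: up_def)

lemma sets_boundary_space: "sets (boundary_space S I) = sigma_sets (boundary S I) (up S I ` traces)"
  using up_subset by (simp add: boundary_space_def sets_measure_of)

lemma boundary_prob_space: "boundary_prob S I P \<Longrightarrow> space P = boundary S I"
  using sets_eq_imp_space_eq[of P "boundary_space S I"]
  by (simp add: boundary_prob_def boundary_space_def space_measure_of_conv)

lemma boundary_prob_up: "boundary_prob S I P \<Longrightarrow> u \<in> traces \<Longrightarrow> up S I u \<in> sets P"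
  by (auto simp: boundary_prob_def sets_boundary_space)

text \<open>With the empty set added, the sets \<open>up u\<close> form an intersection-stable
  generator, and \<open>up_unit\<close> shows that it contains the whole boundary.\<close>

lemma boundary_prob_eqI:
  assumes P: "boundary_prob S I P" and Q: "boundary_prob S I Q"
    and eq: "\<And>u. u \<in> traces \<Longrightarrow> measure P (up S I u) = measure Q (up S I u)"
  shows "P = Q"
proof -
  interpret P: prob_space P using P by (simp add: boundary_prob_def)
  interpret Q: prob_space Q using Q by (simp add: boundary_prob_def)
  let ?E = "insert {} (up S I ` traces)"
  have sig: "sigma_sets (boundary S I) (up S I ` traces) = sigma_sets (boundary S I) ?E"
    by (intro sigma_sets_eqI) (auto intro: sigma_sets.Basic sigma_sets.Empty)
  show ?thesis
  proof (rule measure_eqI_generator_eq[where E = ?E and \<Omega> = "boundary S I" and A = "\<lambda>_. boundary S I"])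
    show "Int_stable ?E" using up_Int by (auto simp: Int_stable_def)
    show "emeasure P X = emeasure Q X" if "X \<in> ?E" for X
      using that eq by (auto simp: P.emeasure_eq_measure Q.emeasure_eq_measure)
    show "sets P = sigma_sets (boundary S I) ?E" "sets Q = sigma_sets (boundary S I) ?E"
      using P Q by (auto simp: boundary_prob_def sets_boundary_space sig)
    show "range (\<lambda>_. boundary S I) \<subseteq> ?E" using up_unit unit_closed by blast
  qed (use up_subset in auto)
qed

text \<open>The pointwise identity \<open>sum_cliques_indicator\<close>, integrated.\<close>

lemma measure_up_recurrence:
  assumes P: "boundary_prob S I P" and u: "u \<in> traces"
  shows "(\<Sum>c\<in>cliques S I. (- 1) ^ len c * measure P (up S I (u \<star> c))) = 0"
proof -
  interpret P: prob_space P using P by (simp add: boundary_prob_def)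
  have m: "up S I (u \<star> c) \<in> sets P" if "c \<in> cliques S I" for c
    using that cliques_subset u by (intro boundary_prob_up[OF P] mul_closed) auto
  have "(\<Sum>c\<in>cliques S I. (- 1) ^ len c * measure P (up S I (u \<star> c))) =
      (\<Sum>c\<in>cliques S I. \<integral>\<xi>. (- 1) ^ len c * indicator (up S I (u \<star> c)) \<xi> \<partial>P)"
    using m sets.sets_into_space[OF m]
    by (intro sum.cong) (auto simp: Int_absorb2)
  also have "\<dots> = (\<integral>\<xi>. (\<Sum>c\<in>cliques S I. (- 1) ^ len c * indicator (up S I (u \<star> c)) \<xi>) \<partial>P)"
    using m by (intro Bochner_Integration.integral_sum[symmetric]) (auto simp: P.emeasure_eq_measure)
  also have "\<dots> = 0" by (simp add: sum_cliques_indicator[OF u])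
  finally show ?thesis .
qed

text \<open>A point in two of the sets \<open>up (u \<star> w)\<close> would give a common multiple,
  contradicting synchronization; the disjoint masses add up to at most 1.\<close>

lemma tcount_measure_up_le_1:
  assumes P: "boundary_prob S I P" and w: "w \<in> traces"
    and sync: "\<forall>u\<in>traces. \<forall>v\<in>traces. \<forall>t\<in>traces. len u = len v \<longrightarrow>
      u \<star> w \<unlhd> t \<longrightarrow> v \<star> w \<unlhd> t \<longrightarrow> u = v"
    and f: "\<And>u. u \<in> traces \<Longrightarrow> len u = n + len w \<Longrightarrow> measure P (up S I u) = q"
  shows "real (tcount n) * q \<le> 1"
proof -
  interpret P: prob_space P using P by (simp add: boundary_prob_def)
  let ?T = "{u \<in> traces. len u = n}"
  have disj: "disjoint_family_on (\<lambda>u. up S I (u \<star> w)) ?T"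
    unfolding disjoint_family_on_def
  proof (intro ballI impI, rule ccontr)
    fix u v assume uv: "u \<in> ?T" "v \<in> ?T" "u \<noteq> v" "up S I (u \<star> w) \<inter> up S I (v \<star> w) \<noteq> {}"
    then obtain \<xi> where \<xi>: "\<xi> \<in> up S I (u \<star> w)" "\<xi> \<in> up S I (v \<star> w)" by blast
    then have b: "\<xi> \<in> boundary S I" by (simp add: up_def)
    obtain s where s: "s \<in> trace_seqs S I" "\<forall>u\<in>traces. \<xi> \<in> up S I u \<longleftrightarrow> (\<exists>k. u \<unlhd> s k)"
    "\<forall>n. \<exists>k. n \<le> len (s k)" by (rule boundaryE[OF b])
    obtain i j where "u \<star> w \<unlhd> s i" "v \<star> w \<unlhd> s j" using s(2) \<xi> uv w by auto
    then have "u \<star> w \<unlhd> s (max i j)" "v \<star> w \<unlhd> s (max i j)"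
      using le_trans[OF _ trace_seqs_mono[OF s(1)], of _ i "max i j"]
        le_trans[OF _ trace_seqs_mono[OF s(1)], of _ j "max i j"] uv w by auto
    then show False using sync[rule_format, of u v "s (max i j)"] uv trace_seqs_closed[OF s(1)] by auto
  qed
  have "real (tcount n) * q = (\<Sum>u\<in>?T. measure P (up S I (u \<star> w)))"
    using f w by (simp add: tcount_def)
  also have "\<dots> = measure P (\<Union>u\<in>?T. up S I (u \<star> w))"
    using disj finite_traces_len boundary_prob_up[OF P] w
    by (intro P.finite_measure_finite_Union[symmetric]) auto
  also have "\<dots> \<le> 1" by (rule P.prob_le_1)
  finally show ?thesis .
qed

text \<open>Uniformity turns the clique identity into a recurrence in the length alone; the bound
  from disjointness leaves only its geometric solution with ratio \<open>p0\<close>.\<close>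

lemma uniform_measure_up:
  assumes irr: "irreducible_pair S I" and p0: "unique_smallest_root (moebius_poly S I) p0"
    and P: "uniform_boundary_measure S I P" and u: "u \<in> traces"
  shows "complex_of_real (measure P (up S I u)) = p0 ^ len u"
proof -
  obtain R where R: "p0 = complex_of_real R" "0 < R" "R \<le> 1" "mob R = 0"
    "\<forall>x. 0 \<le> x \<and> x < R \<longrightarrow> summable (\<lambda>n. real (tcount n) * x ^ n)"
    "\<forall>n. 1 \<le> real (tcount n) * R ^ n" by (rule smallest_root[OF p0])
  have prob: "boundary_prob S I P" using P by (simp add: uniform_boundary_measure_def)
  interpret P: prob_space P using prob by (simp add: boundary_prob_def)
  obtain a where a: "a \<in> S" using S_nonempty by blast
  \<comment> \<open>Powers of one letter serve as representatives of all lengths.\<close>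
  define f where "f n = measure P (up S I (cls (replicate n a)))" for n
  have rep: "replicate n a \<in> lists S" for n using a by (auto simp: in_lists_conv_set)
  have f: "measure P (up S I u) = f (len u)" if "u \<in> traces" for u
    unfolding f_def
    by (rule conjunct2[OF P[unfolded uniform_boundary_measure_def], rule_format])
      (use that rep[of "len u"] in simp_all)
  obtain w where w: "w \<in> traces" "\<forall>u\<in>traces. \<forall>v\<in>traces. \<forall>t\<in>traces.
      len u = len v \<longrightarrow> u \<star> w \<unlhd> t \<longrightarrow> v \<star> w \<unlhd> t \<longrightarrow> u = v"
    by (rule exists_synchronizing_trace[OF irr])
  let ?L = "len w"
  \<comment> \<open>For \<open>n = m + ?L\<close>, disjointness bounds \<open>tcount m * f n\<close>
    by 1, and \<open>tcount m * R ^ m\<close> is at least 1. For \<open>n < ?L\<close>, the trivial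
    bound 1 suffices because \<open>R\<close> is at most 1.\<close>
  have bound: "f n \<le> (1 / R ^ ?L) * R ^ n" for n
  proof (cases "?L \<le> n")
    case True
    then obtain m where n: "n = m + ?L" by (metis le_add_diff_inverse2)
    have "real (tcount m) * f n \<le> 1"
      using f by (intro tcount_measure_up_le_1[OF prob w]) (auto simp: n)
    moreover have "f n \<ge> 0" by (simp add: f_def)
    then have "1 * f n \<le> (real (tcount m) * R ^ m) * f n" by (intro mult_right_mono R(6)[rule_format])
    moreover have "(real (tcount m) * R ^ m) * f n = R ^ m * (real (tcount m) * f n)" by simp
    moreover have "R ^ m * (real (tcount m) * f n) \<le> R ^ m * 1" if "real (tcount m) * f n \<le> 1"
      using that R(2) by (intro mult_left_mono) auto
    ultimately have "f n \<le> R ^ m" by simp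
    then show ?thesis using R(2) by (simp add: n power_add)
  next
    case False
    have "f n \<le> 1" by (simp add: f_def)
    moreover have "R ^ ?L \<le> R ^ n" using False R by (intro power_decreasing) auto
    then have "1 \<le> (1 / R ^ ?L) * R ^ n" using R(2) by (simp add: field_simps)
    ultimately show ?thesis by linarith
  qed
  have "complex_of_real (f (Suc n)) = p0 * complex_of_real (f n)" for n
  proof (rule recurrence_dominated_by_smallest_root)
    show "p0 \<noteq> 0" using R by simp
    \<comment> \<open>The growth identity at 0 excludes the zero polynomial.\<close>
    have "poly (moebius_poly S I) 0 \<noteq> 0"
      using growth_mult_mob[of "0 :: complex"] by (auto simp: poly_moebius_poly)
    then show "moebius_poly S I \<noteq> 0" by auto
    show "z = p0 \<or> cmod p0 < cmod z" if "poly (moebius_poly S I) z = 0" for z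
      using p0 that by (auto simp: unique_smallest_root_def)
    show "cmod (complex_of_real (f n)) \<le> (1 / R ^ ?L) * cmod p0 ^ n" for n
      using bound[of n] R by (simp add: f_def)
    show "shift_op (moebius_poly S I) (\<lambda>n. complex_of_real (f n)) n = 0" for n
    proof -
      have "shift_op (moebius_poly S I) (\<lambda>n. complex_of_real (f n)) n =
          of_real (\<Sum>c\<in>cliques S I. (- 1) ^ len c * f (n + len c))"
        by (simp add: moebius_poly_def shift_op_sum finite_cliques shift_op_monom)
      also have "(\<Sum>c\<in>cliques S I. (- 1) ^ len c * f (n + len c)) =
          (\<Sum>c\<in>cliques S I. (- 1) ^ len c * measure P (up S I (cls (replicate n a) \<star> c)))"
      proof (rule sum.cong[OF HOL.refl])
        fix c assume "c \<in> cliques S I"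
        then have "c \<in> traces" using cliques_subset by blast
        then show "(- 1) ^ len c * f (n + len c) =
            (- 1) ^ len c * measure P (up S I (cls (replicate n a) \<star> c))"
          using f[OF mul_closed[OF cls_in_traces[OF rep]]] rep[of n] len_mul[OF cls_in_traces[OF rep]]
          by simp
      qed
      also have "\<dots> = 0" by (rule measure_up_recurrence[OF prob cls_in_traces[OF rep]])
      finally show ?thesis by simp
    qed
  qed
  then have "complex_of_real (f n) = p0 ^ n * complex_of_real (f 0)" for n
    by (induction n) auto
  moreover have "f 0 = 1"
    using P.prob_space by (simp add: f_def up_unit boundary_prob_space[OF prob])
  ultimately show ?thesis using f[OF u] by simp
qed

end

section \<open>Existence of the uniform measure\<close>

context trace_pair
begin

text \<open>The principal ideal of \<open>v\<close> as a characteristic function; this places the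
  traces in the compact space of predicates.\<close>

definition down :: "'a list set \<Rightarrow> 'a list set \<Rightarrow> bool" where
  "down v u \<longleftrightarrow> u \<in> traces \<and> u \<unlhd> v"

text \<open>The distribution with weights proportional to \<open>s ^ len v\<close>, carried over by
  \<open>down\<close>. By \<open>growth_mult_mob\<close> the factor \<open>mob s\<close> is the
  reciprocal of the total weight, and grouping by length gives a series over the naturals.\<close>

definition boltzmann :: "real \<Rightarrow> ('a list set \<Rightarrow> bool) set \<Rightarrow> real" where
  "boltzmann s A = (\<Sum>n. real (card {v \<in> traces. len v = n \<and> down v \<in> A}) * s ^ n) * mob s"

context
  fixes s :: real
  assumes s: "0 < s" "summable (\<lambda>n. real (tcount n) * s ^ n)"
begin

lemma card_down_le: "card {v \<in> traces. len v = n \<and> down v \<in> A} \<le> tcount n"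
  unfolding tcount_def by (intro card_mono finite_traces_len) auto

lemma summable_boltzmann:
  "summable (\<lambda>n. real (card {v \<in> traces. len v = n \<and> down v \<in> A}) * s ^ n)"
  using s(1) card_down_le
  by (intro summable_comparison_test'[OF s(2)]) (auto intro!: mult_right_mono)

lemma growth_mob_real: "(\<Sum>n. real (tcount n) * s ^ n) * mob s = 1"
  using growth_mult_mob[of s] s by simp

lemma mob_pos: "0 < mob s"
proof -
  have "0 \<le> (\<Sum>n. real (tcount n) * s ^ n)" using s by (intro suminf_nonneg) auto
  then show ?thesis using growth_mob_real by (metis linorder_not_less mult_nonneg_nonpos not_one_le_zero)
qed

lemma boltzmann_nonneg: "0 \<le> boltzmann s A"
  unfolding boltzmann_def using mob_pos s(1)
  by (intro mult_nonneg_nonneg suminf_nonneg summable_boltzmann) auto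

lemma boltzmann_eq_1: "\<forall>v\<in>traces. down v \<in> A \<Longrightarrow> boltzmann s A = 1"
proof -
  assume "\<forall>v\<in>traces. down v \<in> A"
  then have "{v \<in> traces. len v = n \<and> down v \<in> A} = {v \<in> traces. len v = n}" for n by auto
  then show ?thesis using growth_mob_real by (simp add: boltzmann_def tcount_def)
qed

lemma boltzmann_Un: "A \<inter> B = {} \<Longrightarrow> boltzmann s (A \<union> B) = boltzmann s A + boltzmann s B"
proof -
  assume AB: "A \<inter> B = {}"
  have "card {v \<in> traces. len v = n \<and> down v \<in> A \<union> B} =
      card {v \<in> traces. len v = n \<and> down v \<in> A} + card {v \<in> traces. len v = n \<and> down v \<in> B}" for n
  proof -
    have "{v \<in> traces. len v = n \<and> down v \<in> A \<union> B} =
        {v \<in> traces. len v = n \<and> down v \<in> A} \<union> {v \<in> traces. len v = n \<and> down v \<in> B}" by auto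
    then show ?thesis
      using AB finite_subset[OF _ finite_traces_len[of n]]
      by (simp only:) (intro card_Un_disjoint, auto)
  qed
  then show ?thesis
    unfolding boltzmann_def
    by (simp add: distrib_right suminf_add[OF summable_boltzmann summable_boltzmann, symmetric])
qed

lemma boltzmann_le_1: "boltzmann s A \<le> 1"
  using boltzmann_Un[of A "- A"] boltzmann_nonneg[of "- A"] boltzmann_eq_1[of UNIV] by simp

lemma boltzmann_up:
  assumes u: "u \<in> traces"
  shows "boltzmann s {x. x u} = s ^ len u"
proof -
  have "real (card {v \<in> traces. len v = n \<and> down v \<in> {x. x u}}) =
      (if len u \<le> n then real (tcount (n - len u)) else 0)" for n
    using card_multiples[OF u, of n] u by (simp add: down_def)
  then have "boltzmann s {x. x u} =
      (\<Sum>n. (if len u \<le> n then real (tcount (n - len u)) else 0) * s ^ n) * mob s"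
    by (simp only: boltzmann_def)
  also have "\<dots> = (s ^ len u * (\<Sum>n. real (tcount n) * s ^ n)) * mob s"
    using growth_shift_sums[of s "len u"] s by (simp add: sums_iff)
  also have "\<dots> = s ^ len u" using growth_mob_real by (simp add: mult.assoc)
  finally show ?thesis .
qed

text \<open>At most one term of the series survives. The factor \<open>mob s\<close> remains in the
  bound, and it tends to 0 as \<open>s\<close> tends to \<open>R\<close>.\<close>

lemma boltzmann_singleton:
  assumes "\<And>v. v \<in> traces \<Longrightarrow> down v \<in> A \<Longrightarrow> v = u"
  shows "boltzmann s A \<le> s ^ len u * mob s"
proof -
  have c: "card {v \<in> traces. len v = n \<and> down v \<in> A} \<le> (if n = len u then 1 else 0)" for n
  proof (cases "n = len u")
    case True
    have "{v \<in> traces. len v = n \<and> down v \<in> A} \<subseteq> {u}" using assms by auto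
    then show ?thesis using card_mono[of "{u}"] True by simp
  next
    case False
    then have "{v \<in> traces. len v = n \<and> down v \<in> A} = {}" using assms by auto
    then show ?thesis by (simp only: card.empty)
  qed
  have "real (card {v \<in> traces. len v = n \<and> down v \<in> A}) * s ^ n \<le> (if n = len u then s ^ n else 0)" for n
    using c[of n] s(1) by (cases "n = len u") auto
  then have "(\<Sum>n. real (card {v \<in> traces. len v = n \<and> down v \<in> A}) * s ^ n) \<le>
      (\<Sum>n. if n = len u then s ^ n else 0)"
    using sums_single[of "len u" "\<lambda>n. s ^ n"]
    by (intro suminf_le summable_boltzmann) (auto simp: sums_iff)
  also have "\<dots> = s ^ len u" using sums_single[of "len u" "\<lambda>n. s ^ n"] by (simp add: sums_iff)
  finally show ?thesis unfolding boltzmann_def using mob_pos by (intro mult_right_mono) auto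
qed

end

lemma exists_limit_charge:
  assumes R: "0 < R" "mob R = 0"
    "\<forall>x. 0 \<le> x \<and> x < R \<longrightarrow> summable (\<lambda>n. real (tcount n) * x ^ n)"
  obtains \<nu> where "\<forall>A. (0 :: real) \<le> \<nu> A" "\<forall>A B. A \<inter> B = {} \<longrightarrow> \<nu> (A \<union> B) = \<nu> A + \<nu> B"
    "\<forall>A. (\<forall>v\<in>traces. down v \<in> A) \<longrightarrow> \<nu> A = 1"
    "\<forall>u\<in>traces. \<nu> {x. x u} = R ^ len u"
    "\<forall>u A. (\<forall>v\<in>traces. down v \<in> A \<longrightarrow> v = u) \<longrightarrow> \<nu> A = 0"
proof -
  have ev: "eventually (\<lambda>s. 0 < s \<and> s < R \<and> summable (\<lambda>n. real (tcount n) * s ^ n)) (at_left R)"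
    using eventually_at_left_real[OF R(1)] by eventually_elim (use R(3) in auto)
  have "eventually (\<lambda>s. (\<forall>A. 0 \<le> boltzmann s A \<and> boltzmann s A \<le> 1) \<and>
      (\<forall>A B. A \<inter> B = {} \<longrightarrow> boltzmann s (A \<union> B) = boltzmann s A + boltzmann s B)) (at_left R)"
    using ev by eventually_elim (use boltzmann_nonneg boltzmann_le_1 boltzmann_Un in blast)
  then obtain \<nu> where \<nu>: "\<forall>A. 0 \<le> \<nu> A" "\<forall>A B. A \<inter> B = {} \<longrightarrow> \<nu> (A \<union> B) = \<nu> A + \<nu> B"
    "\<forall>A L. ((\<lambda>s. boltzmann s A) \<longlongrightarrow> L) (at_left R) \<longrightarrow> \<nu> A = L"
    by (rule finitely_additive_limit[OF trivial_limit_at_left_real])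
  \<comment> \<open>Where the weights converge, \<open>\<nu>\<close> takes their limit, so the three
    remaining claims are limit computations as \<open>s\<close> increases to
    \<open>R\<close>.\<close>
  show ?thesis
  proof (rule that[OF \<nu>(1,2)]; intro allI ballI impI; rule \<nu>(3)[rule_format])
    fix A assume "\<forall>v\<in>traces. down v \<in> A"
    then have "eventually (\<lambda>s. boltzmann s A = 1) (at_left R)"
      using ev by (auto elim!: eventually_mono intro: boltzmann_eq_1)
    then show "((\<lambda>s. boltzmann s A) \<longlongrightarrow> 1) (at_left R)" by (rule tendsto_eventually)
  next
    fix u assume u: "u \<in> traces"
    have "eventually (\<lambda>s. boltzmann s {x. x u} = s ^ len u) (at_left R)"
      using ev by (auto elim!: eventually_mono intro: boltzmann_up u)
    moreover have "((\<lambda>s. s ^ len u) \<longlongrightarrow> R ^ len u) (at_left R)" by (intro tendsto_intros)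
    ultimately show "((\<lambda>s. boltzmann s {x. x u}) \<longlongrightarrow> R ^ len u) (at_left R)"
      by (subst tendsto_cong)
  next
    fix u A assume *: "\<forall>v\<in>traces. down v \<in> A \<longrightarrow> v = u"
    show "((\<lambda>s. boltzmann s A) \<longlongrightarrow> 0) (at_left R)"
    proof (rule tendsto_sandwich)
      show "eventually (\<lambda>s. 0 \<le> boltzmann s A) (at_left R)"
        using ev by (auto elim!: eventually_mono intro: boltzmann_nonneg)
      show "eventually (\<lambda>s. boltzmann s A \<le> s ^ len u * mob s) (at_left R)"
        using ev * by (auto elim!: eventually_mono intro: boltzmann_singleton)
      have "((\<lambda>s. s ^ len u * mob s) \<longlongrightarrow> R ^ len u * mob R) (at_left R)"
        by (intro tendsto_intros tendsto_mob)
      then show "((\<lambda>s. s ^ len u * mob s) \<longlongrightarrow> 0) (at_left R)" by (simp add: R(2))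
    qed simp
  qed
qed

text \<open>Describes infinite directed ideals. For fixed \<open>u\<close> and \<open>v\<close> each
  clause tests finitely many coordinates, hence the length restrictions on \<open>w\<close>. The
  last clause excludes the principal ideals \<open>down v\<close>.\<close>

definition ideal_pred :: "('a list set \<Rightarrow> bool) \<Rightarrow> bool" where
  "ideal_pred x \<longleftrightarrow> x unit_trace \<and>
    (\<forall>u\<in>traces. \<forall>v\<in>traces. u \<unlhd> v \<and> x v \<longrightarrow> x u) \<and>
    (\<forall>u\<in>traces. \<forall>v\<in>traces. x u \<and> x v \<longrightarrow>
      (\<exists>w\<in>traces. len w \<le> len u + len v \<and> u \<unlhd> w \<and> v \<unlhd> w \<and> x w)) \<and>
    (\<forall>u\<in>traces. x u \<longrightarrow> (\<exists>w\<in>traces. len w = Suc (len u) \<and> u \<unlhd> w \<and> x w))"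

lemma boundary_of_ideal_pred:
  assumes "ideal_pred x"
  shows "\<exists>\<xi>. \<xi> \<in> boundary S I \<and> (\<forall>u\<in>traces. \<xi> \<in> up S I u \<longleftrightarrow> x u)"
proof -
  have ex: "\<exists>u\<in>traces. len u = n \<and> x u" for n
  proof (induction n)
    case 0
    then show ?case using assms by (intro bexI[of _ unit_trace]) (auto simp: ideal_pred_def)
  next
    case (Suc n)
    then obtain u where u: "u \<in> traces" "len u = n" "x u" by blast
    then have "\<exists>w\<in>traces. len w = Suc (len u) \<and> u \<unlhd> w \<and> x w"
      using assms unfolding ideal_pred_def by blast
    then show ?case using u by auto
  qed
  have unb: "\<exists>u\<in>{u \<in> traces. x u}. n \<le> len u" for n using ex[of n] by auto
  have "\<exists>\<xi>\<in>boundary S I. \<forall>u\<in>traces. \<xi> \<in> up S I u \<longleftrightarrow> u \<in> {u \<in> traces. x u}"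
  proof (rule boundary_of_ideal)
    show "u \<in> {u \<in> traces. x u}" if "u \<in> traces" "v \<in> {u \<in> traces. x u}" "u \<unlhd> v" for u v
      using that assms unfolding ideal_pred_def by blast
    show "\<exists>w\<in>{u \<in> traces. x u}. u \<unlhd> w \<and> v \<unlhd> w"
      if "u \<in> {u \<in> traces. x u}" "v \<in> {u \<in> traces. x u}" for u v
    proof -
      have "\<exists>w\<in>traces. len w \<le> len u + len v \<and> u \<unlhd> w \<and> v \<unlhd> w \<and> x w"
        using that assms unfolding ideal_pred_def by simp
      then show ?thesis by blast
    qed
    show "\<exists>u\<in>{u \<in> traces. x u}. n \<le> len u" for n by (rule unb)
  qed auto
  then show ?thesis by auto
qed

lemma finite_traces_len_le: "finite {w \<in> traces. len w \<le> n}"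
proof -
  have "{w \<in> traces. len w \<le> n} = (\<Union>k\<le>n. {w \<in> traces. len w = k})" by auto
  then show ?thesis using finite_traces_len by simp
qed

text \<open>The limit charge extends to a measure \<open>N\<close> on predicates. Each clause of
  \<open>ideal_pred\<close> is a countable family of cylinder events of mass 1, so almost every
  predicate determines a boundary point, and \<open>N\<close> is pushed forward.\<close>

lemma exists_boundary_measure:
  assumes R: "0 < R" "mob R = 0"
    "\<forall>x. 0 \<le> x \<and> x < R \<longrightarrow> summable (\<lambda>n. real (tcount n) * x ^ n)"
  obtains P where "boundary_prob S I P" "\<forall>u\<in>traces. measure P (up S I u) = R ^ len u"
proof -
  obtain \<nu> where \<nu>: "\<forall>A. (0 :: real) \<le> \<nu> A" "\<forall>A B. A \<inter> B = {} \<longrightarrow> \<nu> (A \<union> B) = \<nu> A + \<nu> B"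
    "\<forall>A. (\<forall>v\<in>traces. down v \<in> A) \<longrightarrow> \<nu> A = 1"
    "\<forall>u\<in>traces. \<nu> {x. x u} = R ^ len u"
    "\<forall>u A. (\<forall>v\<in>traces. down v \<in> A \<longrightarrow> v = u) \<longrightarrow> \<nu> A = 0"
    by (rule exists_limit_charge[OF R])
  obtain N where N: "prob_space N" "space N = UNIV"
    "\<forall>A. cylinder A \<longrightarrow> A \<in> sets N \<and> measure N A = \<nu> A"
    by (rule finitely_additive_extension[of \<nu>]) (use \<nu>(1,2,3) in auto)
  interpret N: prob_space N by (rule N(1))
  have AE_I: "AE x in N. Q x" if "cylinder {x. Q x}" "\<nu> {x. Q x} = 1" for Q
    using N.AE_in_set_eq_1[of "{x. Q x}"] N(3) that by auto
  have cyl1: "cylinder {x. x u}" for u :: "'a list set" by (rule cylinderI[of "{u}"]) auto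
  have "AE x in N. x unit_trace"
    by (rule AE_I[OF cyl1], rule \<nu>(3)[rule_format]) (simp add: down_def)
  moreover have "AE x in N. \<forall>u\<in>traces. \<forall>v\<in>traces. u \<unlhd> v \<and> x v \<longrightarrow> x u"
    unfolding AE_ball_countable[OF countable_traces]
  proof (intro ballI)
    fix u v assume uv: "u \<in> traces" "v \<in> traces"
    show "AE x in N. u \<unlhd> v \<and> x v \<longrightarrow> x u"
    proof (rule AE_I)
      show "cylinder {x. u \<unlhd> v \<and> x v \<longrightarrow> x u}" by (rule cylinderI[of "{u, v}"]) auto
      show "\<nu> {x. u \<unlhd> v \<and> x v \<longrightarrow> x u} = 1"
        by (rule \<nu>(3)[rule_format]) (use uv le_trans in \<open>auto simp: down_def\<close>)
    qed
  qed
  \<comment> \<open>Every \<open>down t\<close> satisfies this clause, because the least upper bound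
    of two divisors of \<open>t\<close> divides \<open>t\<close>.\<close>
  moreover have "AE x in N. \<forall>u\<in>traces. \<forall>v\<in>traces. x u \<and> x v \<longrightarrow>
      (\<exists>w\<in>traces. len w \<le> len u + len v \<and> u \<unlhd> w \<and> v \<unlhd> w \<and> x w)"
    unfolding AE_ball_countable[OF countable_traces]
  proof (intro ballI)
    fix u v assume uv: "u \<in> traces" "v \<in> traces"
    let ?Q = "\<lambda>x. x u \<and> x v \<longrightarrow>
      (\<exists>w\<in>traces. len w \<le> len u + len v \<and> u \<unlhd> w \<and> v \<unlhd> w \<and> x w)"
    show "AE x in N. ?Q x"
    proof (rule AE_I)
      show "cylinder {x. ?Q x}"
      proof (rule cylinderI)
        show "finite (insert u (insert v {w \<in> traces. len w \<le> len u + len v}))"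
          by (simp add: finite_traces_len_le)
      qed auto
      show "\<nu> {x. ?Q x} = 1"
      proof (rule \<nu>(3)[rule_format], clarify)
        fix t assume t: "t \<in> traces" "down t u" "down t v"
        obtain w where "w \<in> traces" "u \<unlhd> w" "v \<unlhd> w" "len w \<le> len u + len v"
          "\<forall>t'\<in>traces. u \<unlhd> t' \<longrightarrow> v \<unlhd> t' \<longrightarrow> w \<unlhd> t'"
          by (rule trace_lub[OF uv t(1)]) (use t in \<open>auto simp: down_def\<close>)
        then show "\<exists>w\<in>traces. len w \<le> len u + len v \<and> u \<unlhd> w \<and> v \<unlhd> w \<and> down t w"
          using t by (auto simp: down_def)
      qed
    qed
  qed
  moreover have "AE x in N. \<forall>u\<in>traces. x u \<longrightarrow>
      (\<exists>w\<in>traces. len w = Suc (len u) \<and> u \<unlhd> w \<and> x w)"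
    unfolding AE_ball_countable[OF countable_traces]
  proof (intro ballI)
    fix u assume u: "u \<in> traces"
    let ?Q = "\<lambda>x. x u \<longrightarrow> (\<exists>w\<in>traces. len w = Suc (len u) \<and> u \<unlhd> w \<and> x w)"
    show "AE x in N. ?Q x"
    proof (rule AE_I)
      show "cylinder {x. ?Q x}"
      proof (rule cylinderI)
        show "finite (insert u {w \<in> traces. len w = Suc (len u)})"
          by (simp add: finite_traces_len)
      qed auto
      \<comment> \<open>A trace \<open>v\<close> that fails the clause at \<open>u\<close> is
        \<open>u\<close> itself: a proper multiple of \<open>u\<close> is divisible by
        \<open>u \<star> a\<close> for some \<open>a\<close> of length 1. The charge ignores single
        traces.\<close>
      have "\<nu> (- {x. ?Q x}) = 0"
      proof (rule \<nu>(5)[rule_format, of _ u])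
        fix v assume v: "v \<in> traces" "down v \<in> - {x. ?Q x}"
        then obtain t where t: "t \<in> traces" "v = u \<star> t"
          by (auto simp: down_def factor_def)
        show "v = u"
        proof (rule ccontr)
          assume "v \<noteq> u"
          then have "len t \<noteq> 0" using t u len_eq_0_iff by auto
          then obtain n where "len t = 1 + n" by (metis Suc_pred' add.commute gr0I plus_1_eq_Suc)
          then obtain a b where ab: "a \<in> traces" "b \<in> traces" "len a = 1" "t = a \<star> b"
            using traces_of_len_add[OF t(1)] by metis
          have "u \<star> a \<unlhd> v" using ab t u by (simp add: mul_assoc[symmetric])
          then show False using v(2) ab u by (auto simp: down_def)
        qed
      qed
      moreover have "\<nu> ({x. ?Q x} \<union> - {x. ?Q x}) = \<nu> {x. ?Q x} + \<nu> (- {x. ?Q x})"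
        using \<nu>(2) by blast
      moreover have "\<nu> ({x. ?Q x} \<union> - {x. ?Q x}) = 1" by (rule \<nu>(3)[rule_format]) simp
      ultimately show "\<nu> {x. ?Q x} = 1" by simp
    qed
  qed
  ultimately have AE: "AE x in N. ideal_pred x"
    unfolding ideal_pred_def by eventually_elim blast
  \<comment> \<open>\<open>Z\<close> is a measurable null set containing all exceptional
    predicates.\<close>
  then obtain Z where Z: "{x. \<not> ideal_pred x} \<subseteq> Z" "Z \<in> sets N" "emeasure N Z = 0"
    using N(2) by (auto elim!: AE_E)
  define \<phi> where "\<phi> x = (SOME \<xi>. \<xi> \<in> boundary S I \<and> (\<forall>u\<in>traces. \<xi> \<in> up S I u \<longleftrightarrow> x u))" for x
  have \<phi>: "\<phi> x \<in> boundary S I \<and> (\<forall>u\<in>traces. \<phi> x \<in> up S I u \<longleftrightarrow> x u)" if "x \<notin> Z" for x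
    unfolding \<phi>_def by (rule someI_ex, rule boundary_of_ideal_pred) (use Z that in blast)
  have "Z \<noteq> UNIV" using Z(3) N.emeasure_space_1 N(2) by auto
  then obtain x0 where x0: "x0 \<notin> Z" by blast
  \<comment> \<open>A fixed good predicate \<open>x0\<close> supplies the default on
    \<open>Z\<close>, so that \<open>\<Phi>\<close> maps into the boundary everywhere and is
    constant on \<open>Z\<close>.\<close>
  define \<Phi> where "\<Phi> x = (if x \<in> Z then \<phi> x0 else \<phi> x)" for x
  have \<Phi>_up: "\<Phi> x \<in> up S I u \<longleftrightarrow> (if x \<in> Z then x0 u else x u)" if "u \<in> traces" for x u
    using \<phi>[OF x0] \<phi>[of x] that by (simp add: \<Phi>_def)
  have pre: "\<Phi> -` up S I u \<inter> space N \<in> sets N" if u: "u \<in> traces" for u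
  proof -
    have "\<Phi> -` up S I u \<inter> space N = ({x. x u} - Z) \<union> (if x0 u then Z else {})"
      using N(2) by (auto simp: \<Phi>_up[OF u] split: if_splits)
    moreover have "{x. x u} \<in> sets N" using N(3) cyl1 by blast
    ultimately show ?thesis using Z(2) by auto
  qed
  have meas: "\<Phi> \<in> measurable N (boundary_space S I)"
    unfolding boundary_space_def
  proof (rule measurable_measure_of[OF up_subset])
    show "\<Phi> \<in> space N \<rightarrow> boundary S I" using \<phi> x0 by (auto simp: \<Phi>_def)
    show "\<Phi> -` A \<inter> space N \<in> sets N" if "A \<in> up S I ` traces" for A using that pre by auto
  qed
  define P where "P = distr N (boundary_space S I) \<Phi>"
  have "measure P (up S I u) = R ^ len u" if u: "u \<in> traces" for u
  proof -
    have "measure P (up S I u) = measure N (\<Phi> -` up S I u \<inter> space N)"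
      unfolding P_def using u meas sets_boundary_space
      by (intro measure_distr) (auto intro: sigma_sets.Basic)
    also have "\<dots> = measure N {x. x u}"
    proof (rule N.finite_measure_eq_AE)
      have "AE x in N. x \<notin> Z" using Z(2,3) by (intro AE_not_in) (auto simp: null_sets_def)
      then show "AE x in N. x \<in> \<Phi> -` up S I u \<inter> space N \<longleftrightarrow> x \<in> {x. x u}"
        by eventually_elim (use N(2) in \<open>auto simp: \<Phi>_up[OF u]\<close>)
    qed (use pre[OF u] N(3) cyl1 in auto)
    also have "\<dots> = R ^ len u" using N(3) cyl1 \<nu>(4) u by simp
    finally show ?thesis .
  qed
  moreover have "boundary_prob S I P"
    unfolding boundary_prob_def P_def using N.prob_space_distr[OF meas] by simp
  ultimately show ?thesis using that by blast
qed

text \<open>Multiplicativity reduces the mass of \<open>up u\<close> to a power of the common letter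
  mass. Uniqueness among uniform measures thus covers the uniform Bernoulli ones.\<close>

lemma uniform_bernoulli_imp_uniform:
  assumes "uniform_bernoulli_measure S I P"
  shows "uniform_boundary_measure S I P"
proof -
  have prob: "boundary_prob S I P"
    and mult: "\<And>u v. u \<in> traces \<Longrightarrow> v \<in> traces \<Longrightarrow>
      measure P (up S I (u \<star> v)) = measure P (up S I u) * measure P (up S I v)"
    and letters: "\<And>a b. a \<in> S \<Longrightarrow> b \<in> S \<Longrightarrow>
      measure P (up S I (cls [a])) = measure P (up S I (cls [b]))"
    using assms unfolding uniform_bernoulli_measure_def bernoulli_measure_def by blast+
  interpret P: prob_space P using prob by (simp add: boundary_prob_def)
  obtain b where b: "b \<in> S" using S_nonempty by blast
  define q where "q = measure P (up S I (cls [b]))"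
  have "measure P (up S I (cls w)) = q ^ length w" if "w \<in> lists S" for w
    using that
  proof (induction w)
    case Nil
    then show ?case using P.prob_space by (simp add: up_unit boundary_prob_space[OF prob])
  next
    case (Cons a w)
    then have "measure P (up S I (cls (a # w))) =
        measure P (up S I (cls [a])) * measure P (up S I (cls w))"
      using mult[of "cls [a]" "cls w"] by simp
    then show ?case using Cons letters[OF Cons.hyps(1) b] by (simp add: q_def)
  qed
  then have q: "measure P (up S I u) = q ^ len u" if "u \<in> traces" for u
    using that by (elim tracesE) simp
  show ?thesis
    unfolding uniform_boundary_measure_def
  proof (intro conjI prob ballI impI)
    fix u v assume "u \<in> traces" "v \<in> traces" "len u = len v"
    then show "measure P (up S I u) = measure P (up S I v)" by (simp only: q)
  qed
qed

end

theorem theorem2p6: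
  fixes S :: "'a set" and I :: "('a \<times> 'a) set" and p0 :: complex
  assumes "independence_pair S I"
    and "irreducible_pair S I"
    and "unique_smallest_root (moebius_poly S I) p0"
  shows "\<exists>P0.
    uniform_bernoulli_measure S I P0 \<and>
    (\<forall>P. uniform_bernoulli_measure S I P \<longrightarrow> P = P0) \<and>
    (\<forall>u\<in>carrier (trace_monoid S I).
       complex_of_real (measure P0 (up S I u)) = p0 ^ trace_length u) \<and>
    (\<forall>P. boundary_prob S I P \<and>
       (\<forall>u\<in>carrier (trace_monoid S I).
          complex_of_real (measure P (up S I u)) = p0 ^ trace_length u) \<longrightarrow> P = P0) \<and>
    (\<forall>P. uniform_boundary_measure S I P \<longrightarrow> uniform_bernoulli_measure S I P) \<and>
    uniform_boundary_measure S I P0 \<and>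
    (\<forall>P. uniform_boundary_measure S I P \<longrightarrow> P = P0)"
proof -
  interpret trace_pair S I by unfold_locales (rule assms(1))
  obtain R where R: "p0 = complex_of_real R" "0 < R" "R \<le> 1" "mob R = 0"
    "\<forall>x. 0 \<le> x \<and> x < R \<longrightarrow> summable (\<lambda>n. real (tcount n) * x ^ n)"
    "\<forall>n. 1 \<le> real (tcount n) * R ^ n" by (rule smallest_root[OF assms(3)])
  obtain P0 where P0: "boundary_prob S I P0" "\<forall>u\<in>traces. measure P0 (up S I u) = R ^ len u"
    by (rule exists_boundary_measure[OF R(2,4,5)])
  have uniq: "P = P0" if "boundary_prob S I P"
    "\<forall>u\<in>traces. complex_of_real (measure P (up S I u)) = p0 ^ len u" for P
  proof (rule boundary_prob_eqI[OF that(1) P0(1)])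
    fix u assume u: "u \<in> traces"
    then have "complex_of_real (measure P (up S I u)) = complex_of_real (R ^ len u)"
      using that(2) R(1) by simp
    then show "measure P (up S I u) = measure P0 (up S I u)" using P0(2) u by (simp only: of_real_eq_iff)
  qed
  \<comment> \<open>Positivity comes from \<open>0 < R\<close>, multiplicativity from additivity of
    the length.\<close>
  have ub: "uniform_bernoulli_measure S I P0"
    unfolding uniform_bernoulli_measure_def bernoulli_measure_def
    using P0 R(2) by (simp add: power_add)
  have uni: "P = P0" if "uniform_boundary_measure S I P" for P
  proof (rule uniq)
    show "boundary_prob S I P" using that unfolding uniform_boundary_measure_def by (rule conjunct1)
  qed (intro ballI uniform_measure_up[OF assms(2,3) that])
  show ?thesis
  proof (intro exI[of _ P0] conjI allI impI ballI)
    show "uniform_bernoulli_measure S I P0" by (rule ub)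
    show "P = P0" if "uniform_bernoulli_measure S I P" for P
      using uni uniform_bernoulli_imp_uniform[OF that] by blast
    show "complex_of_real (measure P0 (up S I u)) = p0 ^ trace_length u"
      if "u \<in> carrier (trace_monoid S I)" for u using P0(2) R(1) that by simp
    show "P = P0" if "boundary_prob S I P \<and> (\<forall>u\<in>carrier (trace_monoid S I).
        complex_of_real (measure P (up S I u)) = p0 ^ trace_length u)" for P
      using uniq that by blast
    \<comment> \<open>The Bernoulli property is inherited through the equality with
      \<open>P0\<close>.\<close>
    show "uniform_bernoulli_measure S I P" if "uniform_boundary_measure S I P" for P
      using uni[OF that] ub by simp
    show "uniform_boundary_measure S I P0" by (rule uniform_bernoulli_imp_uniform[OF ub])
    show "P = P0" if "uniform_boundary_measure S I P" for P by (rule uni[OF that])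
  qed
qed

end
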